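(* Let $M$ be a closed connected oriented smooth manifold. The space $\big(\mathscr V\mathscr C^\infty_b,\llbracket\cdot,\cdot\rrbracket\big)$ is a Lie algebroid on $\mathscr F\mathscr C^\infty_b$ with identical anchor; that is, $\big(\mathscr V\mathscr C^\infty_b,\llbracket\cdot,\cdot\rrbracket\big)$ is a real Lie algebra and, for every $V,Z\in\mathscr V\mathscr C^\infty_b$ and every $v\in\mathscr F\mathscr C^\infty_b$, $$\llbracket V,vZ\rrbracket=v\llbracket V,Z\rrbracket+(Vv)Z .$$
   Context: $\mathscr P$ is the set of Borel probability measures on $M$; $\mathfrak X^\infty$ the smooth vector fields on $M$. For $f\in C^\infty(M)$ put $f^\star(\mu)=\mu f=\int f\,d\mu$. Cylinder functions: $\mathscr F\mathscr C^\infty_b$ is the algebra of functions $u:\mathscr P\to\mathbb R$ of the form $u=F\circ(f_1^\star,\dots,f_k^\star)$, $k\in\mathbb N_0$, $F\in C^\infty(\mathbb R^k)$, $f_i\in C^\infty(M)$. Cylinder vector fields: $\mathscr V\mathscr C^\infty_b:=\mathscr F\mathscr C^\infty_b\otimes_{\mathbb R}\mathfrak X^\infty$ (algebraic tensor product), a module over $\mathscr F\mathscr C^\infty_b$; for $V=\sum_iu_i\otimes w_i$ set $V_\mu=\sum_iu_i(\mu)w_i\in\mathfrak X^\infty$. Differential: $\mathbf D_\mu u=\sum_i(\partial_iF)(f_1^\star\mu,\dots,f_k^\star\mu)\,df_i$ (independent of the representation of $u$). Action on functions: $(Vu)(\mu)=\int(\mathbf D_\mu u)(V_\mu)\,d\mu$,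 so $Vu\in\mathscr F\mathscr C^\infty_b$. The map sending $V$ to the derivation $u\mapsto Vu$ is injective, and cylinder vector fields are identified with the corresponding derivations. Bracket: $\llbracket V,Z\rrbracket\in\mathscr V\mathscr C^\infty_b$ is the cylinder vector field with $\llbracket V,Z\rrbracket u=V(Zu)-Z(Vu)$ for all $u\in\mathscr F\mathscr C^\infty_b$. *)

theory Defs
  imports
    "HOL-Analysis.Analysis"
    "HOL-Analysis.Finite_Function_Topology"
    "HOL-Probability.Probability"
    "HOL-Library.Function_Algebras"
    "Jordan_Normal_Form.Determinant"
begin

instantiation "fun" :: (type, real_vector) real_vector
begin

definition scaleR_fun :: "real \<Rightarrow> ('a \<Rightarrow> 'b) \<Rightarrow> 'a \<Rightarrow> 'b"
  where "scaleR_fun c f = (\<lambda>x. c *\<^sub>R f x)"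

instance
  by standard (auto simp: scaleR_fun_def fun_eq_iff scaleR_add_left scaleR_add_right)

end


section \<open>Smooth functions on open subsets of Euclidean space\<close>

text \<open>
  \<open>\<real>\<^sup>k\<close> is \<^term>\<open>Euclidean_space k\<close>, i.e. the sequences vanishing at all indices \<open>\<ge> k\<close>; so \<open>k\<close> may
  be \<open>0\<close> and may be bound inside a formula. Only directions \<open>i < k\<close> are used in
  \<open>partial_deriv\<close>, and then \<open>x(i := t)\<close> stays in \<open>\<real>\<^sup>k\<close>. \<open>C_on k n U F\<close>: all iterated
  partial derivatives of \<open>F\<close> of order at most \<open>n\<close> exist and are continuous on the open set
  \<open>U \<subseteq> \<real>\<^sup>k\<close>.
\<close>

definition partial_deriv :: "nat \<Rightarrow> ((nat \<Rightarrow> real) \<Rightarrow> real) \<Rightarrow> (nat \<Rightarrow> real) \<Rightarrow> real"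
  where "partial_deriv i F x = deriv (\<lambda>t. F (x(i := t))) (x i)"

fun C_on :: "nat \<Rightarrow> nat \<Rightarrow> (nat \<Rightarrow> real) set \<Rightarrow> ((nat \<Rightarrow> real) \<Rightarrow> real) \<Rightarrow> bool"
  where
    "C_on k 0 U F \<longleftrightarrow> continuous_on U F"
  | "C_on k (Suc n) U F \<longleftrightarrow> continuous_on U F \<and>
       (\<forall>i<k. (\<forall>x\<in>U. (\<lambda>t. F (x(i := t))) field_differentiable at (x i)) \<and>
              C_on k n U (partial_deriv i F))"

definition smooth_on :: "nat \<Rightarrow> (nat \<Rightarrow> real) set \<Rightarrow> ((nat \<Rightarrow> real) \<Rightarrow> real) \<Rightarrow> bool"
  where "smooth_on k U F \<longleftrightarrow> (\<forall>n. C_on k n U F)"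


section \<open>Smooth manifolds\<close>

text \<open>
  The manifold is a whole type \<open>'m\<close>; Hausdorff and second countable come from its type classes.
\<close>

type_synonym 'm chart = "'m set \<times> ('m \<Rightarrow> nat \<Rightarrow> real)"

definition is_chart :: "nat \<Rightarrow> ('m::topological_space) chart \<Rightarrow> bool"
  where "is_chart d c \<longleftrightarrow> (case c of (U, \<phi>) \<Rightarrow>
    open U \<and> openin (Euclidean_space d) (\<phi> ` U) \<and> homeomorphism U (\<phi> ` U) \<phi> (inv_into U \<phi>))"

definition transition :: "'m chart \<Rightarrow> 'm chart \<Rightarrow> (nat \<Rightarrow> real) \<Rightarrow> nat \<Rightarrow> real"
  where "transition c c' = snd c' \<circ> inv_into (fst c) (snd c)"

definition transition_domain :: "'m chart \<Rightarrow> 'm chart \<Rightarrow> (nat \<Rightarrow> real) set"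
  where "transition_domain c c' = snd c ` (fst c \<inter> fst c')"

definition smooth_atlas :: "nat \<Rightarrow> ('m::topological_space) chart set \<Rightarrow> bool"
  where "smooth_atlas d A \<longleftrightarrow>
    (\<forall>c\<in>A. is_chart d c) \<and> (\<Union>c\<in>A. fst c) = UNIV \<and>
    (\<forall>c\<in>A. \<forall>c'\<in>A. \<forall>i<d.
       smooth_on d (transition_domain c c') (\<lambda>x. transition c c' x i))"

definition jacobian_det :: "nat \<Rightarrow> 'm chart \<Rightarrow> 'm chart \<Rightarrow> (nat \<Rightarrow> real) \<Rightarrow> real"
  where "jacobian_det d c c' x =
    Determinant.det (Matrix.mat d d (\<lambda>(i, j). partial_deriv j (\<lambda>y. transition c c' y i) x))"

text \<open>An orientation of \<open>(M, A)\<close> is given by an oriented atlas \<open>B\<close> for the smooth structure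
  generated by \<open>A\<close>.\<close>

definition orientation :: "nat \<Rightarrow> ('m::topological_space) chart set \<Rightarrow> 'm chart set \<Rightarrow> bool"
  where "orientation d A B \<longleftrightarrow>
    smooth_atlas d B \<and> smooth_atlas d (A \<union> B) \<and>
    (\<forall>c\<in>B. \<forall>c'\<in>B. \<forall>x\<in>transition_domain c c'. jacobian_det d c c' x > 0)"

definition smooth_functions :: "nat \<Rightarrow> 'm chart set \<Rightarrow> ('m \<Rightarrow> real) set"
  where "smooth_functions d A =
    {f. \<forall>(U, \<phi>)\<in>A. smooth_on d (\<phi> ` U) (f \<circ> inv_into U \<phi>)}"

text \<open>Tangent vectors at \<open>x\<close> are the derivations of \<open>C\<^sup>\<infinity>(M)\<close> at \<open>x\<close>, extended by \<open>0\<close> to all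
  functions so that equality of tangent vectors is equality on \<open>C\<^sup>\<infinity>(M)\<close>.\<close>

definition tangent_space :: "nat \<Rightarrow> 'm chart set \<Rightarrow> 'm \<Rightarrow> (('m \<Rightarrow> real) \<Rightarrow> real) set"
  where "tangent_space d A x = {\<xi>.
    (\<forall>f\<in>smooth_functions d A. \<forall>g\<in>smooth_functions d A.
       \<xi> (f + g) = \<xi> f + \<xi> g \<and> \<xi> (f * g) = f x * \<xi> g + g x * \<xi> f) \<and>
    (\<forall>f\<in>smooth_functions d A. \<forall>c. \<xi> (c *\<^sub>R f) = c * \<xi> f) \<and>
    (\<forall>f. f \<notin> smooth_functions d A \<longrightarrow> \<xi> f = 0)}"

type_synonym 'm vfield = "'m \<Rightarrow> ('m \<Rightarrow> real) \<Rightarrow> real"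

definition vector_fields :: "nat \<Rightarrow> 'm chart set \<Rightarrow> 'm vfield set"
  where "vector_fields d A = {w. (\<forall>x. w x \<in> tangent_space d A x) \<and>
    (\<forall>f\<in>smooth_functions d A. (\<lambda>x. w x f) \<in> smooth_functions d A)}"

text \<open>The covector \<open>df\<^sub>x\<close> is a functional on \<open>T\<^sub>xM\<close>, again extended by \<open>0\<close>.\<close>

definition differential ::
  "nat \<Rightarrow> 'm chart set \<Rightarrow> ('m \<Rightarrow> real) \<Rightarrow> 'm \<Rightarrow> (('m \<Rightarrow> real) \<Rightarrow> real) \<Rightarrow> real"
  where "differential d A f x \<xi> = (if \<xi> \<in> tangent_space d A x then \<xi> f else 0)"


section \<open>Cylinder functions\<close>

typedef (overloaded) 'm borel_prob =
    "{\<mu> :: ('m::topological_space) measure. prob_space \<mu> \<and> sets \<mu> = sets borel}"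
  morphisms measure_of_prob Abs_borel_prob
proof -
  have "prob_space (return borel (undefined :: 'm))"
    by (rule prob_space_return) simp
  then show ?thesis
    by (intro exI[of _ "return borel undefined"]) auto
qed

definition star :: "('m::topological_space \<Rightarrow> real) \<Rightarrow> 'm borel_prob \<Rightarrow> real"
  where "star f \<mu> = (\<integral>x. f x \<partial>measure_of_prob \<mu>)"

definition star_tuple ::
  "nat \<Rightarrow> (nat \<Rightarrow> 'm::topological_space \<Rightarrow> real) \<Rightarrow> 'm borel_prob \<Rightarrow> nat \<Rightarrow> real"
  where "star_tuple k f \<mu> = (\<lambda>i. if i < k then star (f i) \<mu> else 0)"

definition cyl_rep :: "nat \<Rightarrow> 'm::topological_space chart set \<Rightarrow> ('m borel_prob \<Rightarrow> real) \<Rightarrow>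
    nat \<Rightarrow> ((nat \<Rightarrow> real) \<Rightarrow> real) \<Rightarrow> (nat \<Rightarrow> 'm \<Rightarrow> real) \<Rightarrow> bool"
  where "cyl_rep d A u k F f \<longleftrightarrow>
    smooth_on k (topspace (Euclidean_space k)) F \<and>
    (\<forall>i<k. f i \<in> smooth_functions d A) \<and>
    u = F \<circ> star_tuple k f"

definition cyl_functions :: "nat \<Rightarrow> 'm::topological_space chart set \<Rightarrow> ('m borel_prob \<Rightarrow> real) set"
  where "cyl_functions d A = {u. \<exists>k F f. cyl_rep d A u k F f}"

definition cyl_differential :: "nat \<Rightarrow> 'm::topological_space chart set \<Rightarrow>
    ('m borel_prob \<Rightarrow> real) \<Rightarrow> 'm borel_prob \<Rightarrow> 'm \<Rightarrow> (('m \<Rightarrow> real) \<Rightarrow> real) \<Rightarrow> real"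
  where "cyl_differential d A u \<mu> = (THE \<alpha>. \<exists>k F f. cyl_rep d A u k F f \<and>
    \<alpha> = (\<Sum>i<k. partial_deriv i F (star_tuple k f \<mu>) *\<^sub>R differential d A (f i)))"


section \<open>Algebraic tensor products\<close>

text \<open>
  For linear subspaces \<open>S\<close> and \<open>T\<close>, \<open>S \<otimes> T\<close> is the free real vector space on \<open>S \<times> T\<close> modulo the span
  of the bilinearity relations; its elements are represented as cosets. In \<open>tensor_add\<close>,
  \<open>tensor_scale\<close> and \<open>cyl_mult\<close> the result is again a full coset.
\<close>

type_synonym ('a, 'b) tensor = "('a \<times> 'b, real) poly_mapping set"

abbreviation pure :: "'a \<Rightarrow> 'b \<Rightarrow> ('a \<times> 'b, real) poly_mapping"
  where "pure a b \<equiv> Poly_Mapping.single (a, b) 1"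

definition tensor_null ::
  "'a::real_vector set \<Rightarrow> 'b::real_vector set \<Rightarrow> ('a \<times> 'b, real) poly_mapping set"
  where "tensor_null S T = span (
    {pure (a + a') b - pure a b - pure a' b |a a' b. a \<in> S \<and> a' \<in> S \<and> b \<in> T} \<union>
    {pure a (b + b') - pure a b - pure a b' |a b b'. a \<in> S \<and> b \<in> T \<and> b' \<in> T} \<union>
    {pure (c *\<^sub>R a) b - c *\<^sub>R pure a b |c a b. a \<in> S \<and> b \<in> T} \<union>
    {pure a (c *\<^sub>R b) - c *\<^sub>R pure a b |c a b. a \<in> S \<and> b \<in> T})"

definition tensor_coset :: "'a::real_vector set \<Rightarrow> 'b::real_vector set \<Rightarrow>
    ('a \<times> 'b, real) poly_mapping \<Rightarrow> ('a, 'b) tensor"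
  where "tensor_coset S T p = {q. q - p \<in> tensor_null S T}"

definition tensor_product ::
  "'a::real_vector set \<Rightarrow> 'b::real_vector set \<Rightarrow> ('a, 'b) tensor set"
  where "tensor_product S T = {tensor_coset S T p |p. Poly_Mapping.keys p \<subseteq> S \<times> T}"

definition tensor_add :: "'a::real_vector set \<Rightarrow> 'b::real_vector set \<Rightarrow>
    ('a, 'b) tensor \<Rightarrow> ('a, 'b) tensor \<Rightarrow> ('a, 'b) tensor"
  where "tensor_add S T V W = (\<Union>p\<in>V. \<Union>q\<in>W. tensor_coset S T (p + q))"

definition tensor_scale :: "'a::real_vector set \<Rightarrow> 'b::real_vector set \<Rightarrow>
    real \<Rightarrow> ('a, 'b) tensor \<Rightarrow> ('a, 'b) tensor"
  where "tensor_scale S T c V = (\<Union>p\<in>V. tensor_coset S T (c *\<^sub>R p))"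

text \<open>The linear extension of \<open>(a, b) \<mapsto> \<beta> a b\<close> to the free vector space.\<close>

definition linear_ext ::
  "('a \<Rightarrow> 'b \<Rightarrow> 'c::real_vector) \<Rightarrow> ('a \<times> 'b, real) poly_mapping \<Rightarrow> 'c"
  where "linear_ext \<beta> p =
    (\<Sum>(a, b)\<in>Poly_Mapping.keys p. Poly_Mapping.lookup p (a, b) *\<^sub>R \<beta> a b)"


section \<open>Cylinder vector fields\<close>

type_synonym 'm cyl_vfield = "('m borel_prob \<Rightarrow> real, 'm vfield) tensor"

definition cyl_vector_fields :: "nat \<Rightarrow> 'm::topological_space chart set \<Rightarrow> 'm cyl_vfield set"
  where "cyl_vector_fields d A = tensor_product (cyl_functions d A) (vector_fields d A)"

definition cyl_add :: "nat \<Rightarrow> 'm::topological_space chart set \<Rightarrow>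
    'm cyl_vfield \<Rightarrow> 'm cyl_vfield \<Rightarrow> 'm cyl_vfield"
  where "cyl_add d A = tensor_add (cyl_functions d A) (vector_fields d A)"

definition cyl_scale :: "nat \<Rightarrow> 'm::topological_space chart set \<Rightarrow>
    real \<Rightarrow> 'm cyl_vfield \<Rightarrow> 'm cyl_vfield"
  where "cyl_scale d A = tensor_scale (cyl_functions d A) (vector_fields d A)"

definition cyl_zero :: "nat \<Rightarrow> 'm::topological_space chart set \<Rightarrow> 'm cyl_vfield"
  where "cyl_zero d A = tensor_coset (cyl_functions d A) (vector_fields d A) 0"

text \<open>Module structure over the cylinder functions: \<open>v (u \<otimes> w) = (v u) \<otimes> w\<close>.\<close>

definition cyl_mult :: "nat \<Rightarrow> 'm::topological_space chart set \<Rightarrow>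
    ('m borel_prob \<Rightarrow> real) \<Rightarrow> 'm cyl_vfield \<Rightarrow> 'm cyl_vfield"
  where "cyl_mult d A v V = (\<Union>p\<in>V.
    tensor_coset (cyl_functions d A) (vector_fields d A) (linear_ext (\<lambda>u w. pure (v * u) w) p))"

definition cyl_eval :: "'m::topological_space cyl_vfield \<Rightarrow> 'm borel_prob \<Rightarrow> 'm vfield"
  where "cyl_eval V \<mu> = (THE X. \<exists>p\<in>V. X = linear_ext (\<lambda>u w. u \<mu> *\<^sub>R w) p)"

definition cyl_action :: "nat \<Rightarrow> 'm::topological_space chart set \<Rightarrow>
    'm cyl_vfield \<Rightarrow> ('m borel_prob \<Rightarrow> real) \<Rightarrow> 'm borel_prob \<Rightarrow> real"
  where "cyl_action d A V u \<mu> =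
    (\<integral>x. cyl_differential d A u \<mu> x (cyl_eval V \<mu> x) \<partial>measure_of_prob \<mu>)"

definition cyl_bracket :: "nat \<Rightarrow> 'm::topological_space chart set \<Rightarrow>
    'm cyl_vfield \<Rightarrow> 'm cyl_vfield \<Rightarrow> 'm cyl_vfield"
  where "cyl_bracket d A V Z = (THE W. W \<in> cyl_vector_fields d A \<and>
    (\<forall>u\<in>cyl_functions d A. cyl_action d A W u =
       cyl_action d A V (cyl_action d A Z u) - cyl_action d A Z (cyl_action d A V u)))"


section \<open>Real Lie algebras\<close>

locale real_vector_space_on =
  fixes L :: "'v set"
    and add :: "'v \<Rightarrow> 'v \<Rightarrow> 'v"
    and zero :: 'v
    and scale :: "real \<Rightarrow> 'v \<Rightarrow> 'v"
  assumes add_closed: "x \<in> L \<Longrightarrow> y \<in> L \<Longrightarrow> add x y \<in> L"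
    and zero_closed: "zero \<in> L"
    and scale_closed: "x \<in> L \<Longrightarrow> scale a x \<in> L"
    and add_assoc: "x \<in> L \<Longrightarrow> y \<in> L \<Longrightarrow> z \<in> L \<Longrightarrow> add (add x y) z = add x (add y z)"
    and add_commute: "x \<in> L \<Longrightarrow> y \<in> L \<Longrightarrow> add x y = add y x"
    and add_zero: "x \<in> L \<Longrightarrow> add zero x = x"
    and add_inverse: "x \<in> L \<Longrightarrow> \<exists>y\<in>L. add x y = zero"
    and scale_add_right: "x \<in> L \<Longrightarrow> y \<in> L \<Longrightarrow> scale a (add x y) = add (scale a x) (scale a y)"
    and scale_add_left: "x \<in> L \<Longrightarrow> scale (a + b) x = add (scale a x) (scale b x)"
    and scale_scale: "x \<in> L \<Longrightarrow> scale a (scale b x) = scale (a * b) x"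
    and scale_one: "x \<in> L \<Longrightarrow> scale 1 x = x"

locale real_lie_algebra_on = real_vector_space_on L add zero scale
  for L :: "'v set" and add zero scale +
  fixes bracket :: "'v \<Rightarrow> 'v \<Rightarrow> 'v"
  assumes bracket_closed: "x \<in> L \<Longrightarrow> y \<in> L \<Longrightarrow> bracket x y \<in> L"
    and bracket_add_left: "x \<in> L \<Longrightarrow> y \<in> L \<Longrightarrow> z \<in> L \<Longrightarrow>
      bracket (add x y) z = add (bracket x z) (bracket y z)"
    and bracket_add_right: "x \<in> L \<Longrightarrow> y \<in> L \<Longrightarrow> z \<in> L \<Longrightarrow>
      bracket x (add y z) = add (bracket x y) (bracket x z)"
    and bracket_scale_left: "x \<in> L \<Longrightarrow> y \<in> L \<Longrightarrow>
      bracket (scale a x) y = scale a (bracket x y)"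
    and bracket_scale_right: "x \<in> L \<Longrightarrow> y \<in> L \<Longrightarrow>
      bracket x (scale a y) = scale a (bracket x y)"
    and bracket_self: "x \<in> L \<Longrightarrow> bracket x x = zero"
    and jacobi: "x \<in> L \<Longrightarrow> y \<in> L \<Longrightarrow> z \<in> L \<Longrightarrow>
      add (bracket x (bracket y z)) (add (bracket y (bracket z x)) (bracket z (bracket x y))) = zero"

end

theory Submission
  imports Defs
begin

text \<open>
  A cylinder vector field acts on cylinder functions as a derivation, and this action is faithful.
  Once that is known, the bracket is the commutator, which exists because it does on elementary
  tensors (symmetry of second derivatives), and all the axioms are identities between derivations.

  For faithfulness, write the field as \<open>\<Sum>\<^sub>b u\<^sub>b \<otimes> b\<close> with linearly independent vector fields \<open>b\<close>. If it
  kills every \<open>f\<^sup>\<star>\<close> then \<open>\<Sum>\<^sub>b u\<^sub>b(\<nu>) \<integral>b f d\<nu> = 0\<close> for all \<open>\<nu>\<close>, and differentiating along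
  \<open>(1 - t) \<mu> + t \<delta>\<^sub>x\<close> at \<open>t = 0\<close> expresses \<open>(V f)(x)\<close>, where \<open>V = \<Sum>\<^sub>b u\<^sub>b(\<mu>) b\<close>, as
  \<open>\<Sum>\<^sub>b L\<^sub>b(f) k\<^sub>b(x)\<close>. A vector field of finite rank on a connected manifold vanishes, so \<open>V = 0\<close> and all
  \<open>u\<^sub>b(\<mu>)\<close> are \<open>0\<close>. No bump functions are needed.
\<close>


section \<open>Calculus of iterated partial derivatives\<close>

text \<open>Faithfulness carries the weight because the bracket is a definite description in a
  quotient space: two candidates with the same action must be the same coset, so a vanishing action
  has to be turned into membership in \<open>tensor_null\<close>. A field that is zero at every
  \<mu> is not yet that. The gap is closed by rewriting it over linearly independent b and using
  their independence at each \<mu> separately, where the coefficients are scalars.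

  A measure \<mu> sees a vector field only through integrals, and its support may miss most of M.
  Mixing in a little mass at x makes the value at x visible. The price is a second term, the
  derivative of the coefficient function towards that point mass. It depends on x but not on f,
  while the integral that multiplies it depends on f but not on x. This separation of variables is
  the source of the finite rank, with one term for each b.

  The same one-sided derivative also shows that the differential of a cylinder function does not
  depend on its representation.\<close>

lemma fun_upd_Euclidean_space:
  "x \<in> topspace (Euclidean_space k) \<Longrightarrow> i < k \<Longrightarrow> x(i := t) \<in> topspace (Euclidean_space k)"
  by (auto simp: topspace_Euclidean_space)

lemma tendsto_fun:
  fixes f :: "'b \<Rightarrow> 'i \<Rightarrow> 'a::topological_space"
  assumes "\<And>i. ((\<lambda>t. f t i) \<longlongrightarrow> l i) F"
  shows "(f \<longlongrightarrow> l) F"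
proof -
  have "limitin (product_topology (\<lambda>i. euclidean) UNIV) f l F"
    unfolding limitin_componentwise using assms by auto
  then show ?thesis
    by (simp add: euclidean_product_topology)
qed

lemma continuous_on_coordinate_section:
  "continuous_on UNIV (\<lambda>t. x(i := t))" for x :: "'i \<Rightarrow> 'a::topological_space"
proof (rule continuous_on_coordinatewise_then_product)
  fix j show "continuous_on UNIV (\<lambda>t. (x(i := t)) j)"
    by (cases "i = j") auto
qed

text \<open>All the openness needed to differentiate on \<open>U\<close>: a point of \<open>U\<close> may be moved a little along
  each coordinate axis.\<close>

definition coord_open :: "nat \<Rightarrow> (nat \<Rightarrow> real) set \<Rightarrow> bool"
  where "coord_open k U \<longleftrightarrow> (\<forall>x\<in>U. \<forall>i<k. eventually (\<lambda>t. x(i := t) \<in> U) (nhds (x i)))"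

lemma coord_open_Euclidean_space: "coord_open k (topspace (Euclidean_space k))"
  by (auto simp: coord_open_def fun_upd_Euclidean_space)

lemma coord_open_openin:
  assumes "openin (Euclidean_space k) U"
  shows "coord_open k U"
  unfolding coord_open_def
proof (intro ballI allI impI)
  fix x i assume x: "x \<in> U" and i: "i < k"
  obtain T where T: "open T" "U = T \<inter> {x. \<forall>i\<ge>k. x i = 0}"
    using assms unfolding Euclidean_space_def openin_subtopology euclidean_product_topology by auto
  have "open ((\<lambda>t. x(i := t)) -` T)"
    using continuous_on_coordinate_section T(1) by (rule open_vimage[rotated])
  then have "eventually (\<lambda>t. t \<in> (\<lambda>t. x(i := t)) -` T) (nhds (x i))"
    using x T(2) by (intro eventually_nhds_in_open) auto
  then show "eventually (\<lambda>t. x(i := t) \<in> U) (nhds (x i))"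
    using x i T(2) by (auto elim!: eventually_mono)
qed

lemma eventually_coord_section_eq:
  assumes "coord_open k U" "x \<in> U" "i < k" "\<And>y. y \<in> U \<Longrightarrow> F y = G y"
  shows "eventually (\<lambda>t. F (x(i := t)) = G (x(i := t))) (nhds (x i))"
proof -
  have "eventually (\<lambda>t. x(i := t) \<in> U) (nhds (x i))"
    using assms(1-3) unfolding coord_open_def by blast
  then show ?thesis by (rule eventually_mono) (rule assms(4))
qed

text \<open>Agreement on U controls derivatives because \<open>coord_open\<close> keeps a short axis
  segment through each point inside U: along the axis the two functions agree near
  \<open>x i\<close>, not just at it.\<close>

lemma C_on_cong:
  assumes "coord_open k U" "\<And>y. y \<in> U \<Longrightarrow> F y = G y" "C_on k n U F"
  shows "C_on k n U G"
  using assms(2,3)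
proof (induction n arbitrary: F G)
  case 0
  then show ?case by (auto cong: continuous_on_cong)
next
  case (Suc n)
  have ev: "eventually (\<lambda>t. F (x(i := t)) = G (x(i := t))) (nhds (x i))" if "x \<in> U" "i < k" for x i
    using that assms(1) Suc.prems(1) by (intro eventually_coord_section_eq)
  have eq: "partial_deriv i F x = partial_deriv i G x" if "x \<in> U" "i < k" for x i
    unfolding partial_deriv_def by (rule deriv_cong_ev[OF ev[OF that]]) simp
  have "(\<lambda>t. G (x(i := t))) field_differentiable at (x i)" if "x \<in> U" "i < k" for x i
  proof -
    have "(\<lambda>t. F (x(i := t))) field_differentiable at (x i)" using Suc.prems that by auto
    then show ?thesis
      unfolding field_differentiable_def using DERIV_cong_ev[OF refl ev[OF that] refl] by blast
  qed
  moreover have "C_on k n U (partial_deriv i G)" if "i < k" for i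
    using Suc.IH[of "partial_deriv i F" "partial_deriv i G"] eq Suc.prems that by auto
  moreover have "continuous_on U G"
    using Suc.prems by (auto cong: continuous_on_cong)
  ultimately show ?case by auto
qed

section \<open>Closure of iterated differentiability under sums and products\<close>

lemma C_on_continuous: "C_on k n U F \<Longrightarrow> continuous_on U F"
  by (cases n) auto

text \<open>\<open>C_on\<close> speaks of \<open>partial_deriv\<close>, a value of
  \<open>deriv\<close>. This rule lets a closure proof supply its own formula G for the derivative,
  which has to be right on U only.\<close>

lemma C_on_SucI:
  assumes "coord_open k U" "continuous_on U F"
    and D: "\<And>i x. i < k \<Longrightarrow> x \<in> U \<Longrightarrow> ((\<lambda>t. F (x(i := t))) has_real_derivative G i x) (at (x i))"
    and G: "\<And>i. i < k \<Longrightarrow> C_on k n U (G i)"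
  shows "C_on k (Suc n) U F"
proof -
  have "C_on k n U (partial_deriv i F)" if "i < k" for i
    by (rule C_on_cong[OF assms(1) _ G[OF that]])
      (simp add: partial_deriv_def DERIV_imp_deriv[OF D[OF that]])
  then show ?thesis
    using assms(2) D by (auto simp: field_differentiable_def)
qed

lemma C_on_partial_deriv:
  assumes "C_on k (Suc n) U F" "i < k" "x \<in> U"
  shows "((\<lambda>t. F (x(i := t))) has_real_derivative partial_deriv i F x) (at (x i))"
  using assms by (auto simp: partial_deriv_def DERIV_deriv_iff_field_differentiable)

lemma C_on_Suc_D: "C_on k (Suc n) U F \<Longrightarrow> C_on k n U F"
  by (induction n arbitrary: F) auto

lemma C_on_const: "coord_open k U \<Longrightarrow> C_on k n U (\<lambda>x. c)"
proof (induction n arbitrary: c)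
  case (Suc n)
  then show ?case by (intro C_on_SucI[where G="\<lambda>i x. 0"]) auto
qed auto

lemma C_on_coordinate: "coord_open k U \<Longrightarrow> C_on k n U (\<lambda>x. x i)"
proof (cases n)
  case (Suc m)
  assume "coord_open k U"
  then show ?thesis unfolding Suc
  proof (rule C_on_SucI[where G="\<lambda>j x. if j = i then 1 else 0"])
    fix j :: nat and x :: "nat \<Rightarrow> real"
    show "((\<lambda>t. (x(j := t)) i) has_real_derivative (if j = i then 1 else 0)) (at (x j))"
      by auto
  qed (use \<open>coord_open k U\<close> in \<open>auto simp: C_on_const intro: continuous_on_subset[OF continuous_on_product_coordinates]\<close>)
qed (auto intro: continuous_on_subset[OF continuous_on_product_coordinates])

lemma C_on_add:
  assumes "coord_open k U" "C_on k n U F" "C_on k n U G"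
  shows "C_on k n U (\<lambda>x. F x + G x)"
  using assms(2,3)
proof (induction n arbitrary: F G)
  case (Suc n)
  show ?case
    using Suc.prems C_on_partial_deriv[OF Suc.prems(1)] C_on_partial_deriv[OF Suc.prems(2)] Suc.IH
    by (intro C_on_SucI[where G="\<lambda>i x. partial_deriv i F x + partial_deriv i G x"] assms(1)
        continuous_intros DERIV_add) auto
qed (auto intro: continuous_intros)

lemma C_on_mult:
  assumes "coord_open k U" "C_on k n U F" "C_on k n U G"
  shows "C_on k n U (\<lambda>x. F x * G x)"
  using assms(2,3)
proof (induction n arbitrary: F G)
  case (Suc n)
  note D = C_on_partial_deriv[OF Suc.prems(1)] C_on_partial_deriv[OF Suc.prems(2)]
  have "((\<lambda>t. F (x(i := t)) * G (x(i := t))) has_real_derivative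
      partial_deriv i F x * G x + F x * partial_deriv i G x) (at (x i))" if "i < k" "x \<in> U" for i x
    by (rule DERIV_cong[OF DERIV_mult[OF D(1)[OF that] D(2)[OF that]]]) (simp add: algebra_simps)
  moreover have "C_on k n U (\<lambda>x. partial_deriv i F x * G x + F x * partial_deriv i G x)" if "i < k" for i
    using Suc.prems that
    by (intro C_on_add Suc.IH assms(1) C_on_Suc_D[OF Suc.prems(1)] C_on_Suc_D[OF Suc.prems(2)]) auto
  moreover have "continuous_on U (\<lambda>x. F x * G x)"
    using Suc.prems by (auto intro: continuous_intros)
  ultimately show ?case by (intro C_on_SucI[OF assms(1)])
qed (auto intro: continuous_intros)

lemma smooth_on_const: "coord_open k U \<Longrightarrow> smooth_on k U (\<lambda>x. c)"
  and smooth_on_coordinate: "coord_open k U \<Longrightarrow> smooth_on k U (\<lambda>x. x i)"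
  and smooth_on_add: "coord_open k U \<Longrightarrow> smooth_on k U F \<Longrightarrow> smooth_on k U G \<Longrightarrow>
    smooth_on k U (\<lambda>x. F x + G x)"
  and smooth_on_mult: "coord_open k U \<Longrightarrow> smooth_on k U F \<Longrightarrow> smooth_on k U G \<Longrightarrow>
    smooth_on k U (\<lambda>x. F x * G x)"
  by (auto simp: smooth_on_def C_on_const C_on_coordinate C_on_add C_on_mult)

lemma smooth_on_continuous: "smooth_on k U F \<Longrightarrow> continuous_on U F"
  unfolding smooth_on_def using C_on_continuous by blast

lemma smooth_on_partial_deriv:
  assumes "smooth_on k U F" "i < k"
  shows "smooth_on k U (partial_deriv i F)"
  unfolding smooth_on_def
proof
  fix n
  have "C_on k (Suc n) U F" using assms(1) unfolding smooth_on_def by blast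
  then show "C_on k n U (partial_deriv i F)" using assms(2) by auto
qed

lemma smooth_on_has_partial_deriv:
  assumes "smooth_on k U F" "i < k" "x \<in> U"
  shows "((\<lambda>t. F (x(i := t))) has_real_derivative partial_deriv i F x) (at (x i))"
  using assms C_on_partial_deriv[of k 0] unfolding smooth_on_def by blast

lemma partial_deriv_add:
  assumes "smooth_on k U F" "smooth_on k U G" "i < k" "x \<in> U"
  shows "partial_deriv i (\<lambda>x. F x + G x) x = partial_deriv i F x + partial_deriv i G x"
  unfolding partial_deriv_def[of i "\<lambda>x. F x + G x"]
  using DERIV_add[OF smooth_on_has_partial_deriv[OF assms(1,3,4)]
      smooth_on_has_partial_deriv[OF assms(2,3,4)]]
  by (intro DERIV_imp_deriv) simp

lemma partial_deriv_mult:
  assumes "smooth_on k U F" "smooth_on k U G" "i < k" "x \<in> U"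
  shows "partial_deriv i (\<lambda>x. F x * G x) x = partial_deriv i F x * G x + F x * partial_deriv i G x"
  unfolding partial_deriv_def[of i "\<lambda>x. F x * G x"]
  using DERIV_mult[OF smooth_on_has_partial_deriv[OF assms(1,3,4)]
      smooth_on_has_partial_deriv[OF assms(2,3,4)]]
  by (intro DERIV_imp_deriv) (simp add: algebra_simps)

lemma partial_deriv_coordinate: "partial_deriv j (\<lambda>x. x i) x = (if j = i then 1 else 0)"
  unfolding partial_deriv_def by (rule DERIV_imp_deriv) auto

section \<open>Reindexing of coordinates\<close>

definition select_coords :: "nat \<Rightarrow> (nat \<Rightarrow> nat) \<Rightarrow> (nat \<Rightarrow> real) \<Rightarrow> nat \<Rightarrow> real"
  where "select_coords l \<sigma> x = (\<lambda>i. if i < l then x (\<sigma> i) else 0)"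

lemma select_coords_in: "select_coords l \<sigma> x \<in> topspace (Euclidean_space l)"
  by (auto simp: select_coords_def topspace_Euclidean_space)

lemma continuous_select_coords: "continuous_on U (select_coords l \<sigma>)"
proof (rule continuous_on_coordinatewise_then_product)
  fix i show "continuous_on U (\<lambda>x. select_coords l \<sigma> x i)"
    by (cases "i < l")
      (auto simp: select_coords_def intro: continuous_on_subset[OF continuous_on_product_coordinates])
qed

text \<open>Since \<open>\<sigma>\<close> is injective, each coordinate of x enters at most one
  argument of F. The chain rule then has at most one term, and one-variable derivatives
  suffice.\<close>

lemma C_on_select_coords:
  assumes "inj_on \<sigma> {..<l}" "C_on l n (topspace (Euclidean_space l)) F"
  shows "C_on k n (topspace (Euclidean_space k)) (\<lambda>x. F (select_coords l \<sigma> x))"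
  using assms(2)
proof (induction n arbitrary: F)
  case 0
  then show ?case
    by (auto intro!: continuous_on_compose2[OF _ continuous_select_coords] select_coords_in)
next
  case (Suc n)
  define G where "G j x = (if \<exists>i<l. \<sigma> i = j
    then partial_deriv (THE i. i < l \<and> \<sigma> i = j) F (select_coords l \<sigma> x) else 0)" for j x
  have the: "(THE i. i < l \<and> \<sigma> i = \<sigma> i0) = i0" if "i0 < l" for i0
    using that assms(1) by (auto simp: inj_on_def)
  show ?case
  proof (rule C_on_SucI[where G=G])
    show "continuous_on (topspace (Euclidean_space k)) (\<lambda>x. F (select_coords l \<sigma> x))"
      using Suc.prems
      by (auto intro!: continuous_on_compose2[OF _ continuous_select_coords] select_coords_in)
    fix j x
    show "((\<lambda>t. F (select_coords l \<sigma> (x(j := t)))) has_real_derivative G j x) (at (x j))"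
    proof (cases "\<exists>i<l. \<sigma> i = j")
      case True
      then obtain i where i: "i < l" "\<sigma> i = j" by auto
      have "select_coords l \<sigma> (x(j := t)) = (select_coords l \<sigma> x)(i := t)" for t
        using assms(1) i by (auto simp: select_coords_def fun_eq_iff inj_on_def)
      moreover have "select_coords l \<sigma> x i = x j" using i by (simp add: select_coords_def)
      moreover have "G j x = partial_deriv i F (select_coords l \<sigma> x)"
        using i the by (auto simp: G_def)
      ultimately show ?thesis
        using C_on_partial_deriv[OF Suc.prems i(1) select_coords_in[of l \<sigma> x]] by (simp only:)
    next
      case False
      then have "select_coords l \<sigma> (x(j := t)) = select_coords l \<sigma> x" for t
        by (auto simp: select_coords_def fun_eq_iff)
      then show ?thesis using False by (auto simp: G_def)
    qed
  next
    fix j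
    show "C_on k n (topspace (Euclidean_space k)) (G j)"
    proof (cases "\<exists>i<l. \<sigma> i = j")
      case True
      then obtain i where i: "i < l" "\<sigma> i = j" by auto
      then have "G j = (\<lambda>x. partial_deriv i F (select_coords l \<sigma> x))"
        using the by (auto simp: G_def fun_eq_iff)
      then show ?thesis using Suc.IH[of "partial_deriv i F"] Suc.prems i by auto
    next
      case False
      then have "G j = (\<lambda>x. 0)" by (auto simp: G_def fun_eq_iff)
      then show ?thesis by (simp add: C_on_const coord_open_Euclidean_space)
    qed
  qed (rule coord_open_Euclidean_space)
qed

lemma smooth_on_select_coords:
  "inj_on \<sigma> {..<l} \<Longrightarrow> smooth_on l (topspace (Euclidean_space l)) F \<Longrightarrow>
    smooth_on k (topspace (Euclidean_space k)) (\<lambda>x. F (select_coords l \<sigma> x))"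
  by (auto simp: smooth_on_def C_on_select_coords)

section \<open>Mean value theorem and derivatives along lines\<close>

lemma partial_MVT:
  assumes F: "smooth_on k (topspace (Euclidean_space k)) F" and "i < k"
    and x: "x \<in> topspace (Euclidean_space k)"
  shows "\<exists>s. \<bar>s - x i\<bar> \<le> \<bar>h\<bar> \<and> F (x(i := x i + h)) - F x = h * partial_deriv i F (x(i := s))"
proof -
  have D: "((\<lambda>t. F (x(i := t))) has_real_derivative partial_deriv i F (x(i := s))) (at s)" for s
    using smooth_on_has_partial_deriv[OF F \<open>i < k\<close> fun_upd_Euclidean_space[OF x \<open>i < k\<close>, of s]]
    by simp
  \<comment> \<open>\<open>MVT2\<close> wants an ordered interval. The weak bound on s covers all
    three cases, so that s can later be chosen for every increment at once.\<close>
  consider "h = 0" | "h > 0" | "h < 0" by linarith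
  then show ?thesis
  proof cases
    case 1
    then show ?thesis by (intro exI[of _ "x i"]) auto
  next
    case 2
    from MVT2[of "x i" "x i + h" "\<lambda>t. F (x(i := t))" "\<lambda>s. partial_deriv i F (x(i := s))"] D 2
    obtain z where "x i < z" "z < x i + h"
      "F (x(i := x i + h)) - F (x(i := x i)) = (x i + h - x i) * partial_deriv i F (x(i := z))"
      by auto
    then show ?thesis by (intro exI[of _ z]) auto
  next
    case 3
    from MVT2[of "x i + h" "x i" "\<lambda>t. F (x(i := t))" "\<lambda>s. partial_deriv i F (x(i := s))"] D 3
    obtain z where "x i + h < z" "z < x i"
      "F (x(i := x i)) - F (x(i := x i + h)) = (x i - (x i + h)) * partial_deriv i F (x(i := z))"
      by auto
    then show ?thesis by (intro exI[of _ z]) auto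
  qed
qed

text \<open>Coordinates are moved one at a time. In the induction on m the last move contributes an
  increment given by the mean value theorem, and continuity of the partial derivative identifies its
  slope at 0. The case \<open>m = k\<close> takes the place of a multivariate chain rule.\<close>

lemma partial_has_line_derivative:
  assumes F: "smooth_on k (topspace (Euclidean_space k)) F"
    and x: "x \<in> topspace (Euclidean_space k)" and "m \<le> k"
  shows "((\<lambda>t. F (\<lambda>i. if i < m then x i + t * b i else x i)) has_real_derivative
    (\<Sum>i<m. partial_deriv i F x * b i)) (at 0)"
  using \<open>m \<le> k\<close>
proof (induction m)
  case (Suc m)
  define y where "y t = (\<lambda>i. if i < m then x i + t * b i else x i)" for t
  have m: "m < k" using Suc.prems by simp
  have y: "y t \<in> topspace (Euclidean_space k)" for t
    using x m by (auto simp: y_def topspace_Euclidean_space)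
  have "\<exists>s. \<bar>s - x m\<bar> \<le> \<bar>t * b m\<bar> \<and>
      F ((y t)(m := x m + t * b m)) - F (y t) = t * b m * partial_deriv m F ((y t)(m := s))" for t
    using partial_MVT[OF F m y, of t "t * b m"] by (simp add: y_def)
  then obtain s where s: "\<And>t. \<bar>s t - x m\<bar> \<le> \<bar>t * b m\<bar>"
    and eq: "\<And>t. F ((y t)(m := x m + t * b m)) - F (y t) = t * b m * partial_deriv m F ((y t)(m := s t))"
    by metis
  \<comment> \<open>Nothing is known about s, which comes from choice, except that it is squeezed to
    \<open>x m\<close> at 0. So the increment \<open>t * b m * Q t\<close> is differentiated at 0
    only, where its difference quotient is \<open>b m * Q t\<close>.\<close>
  define Q where "Q t = partial_deriv m F ((y t)(m := s t))" for t
  have s_lim: "(s \<longlongrightarrow> x m) (at 0)"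
  proof -
    have "((\<lambda>t. s t - x m) \<longlongrightarrow> 0) (at 0)"
    proof (rule Lim_null_comparison)
      show "\<forall>\<^sub>F t in at 0. norm (s t - x m) \<le> \<bar>t * b m\<bar>" using s by auto
      show "((\<lambda>t. \<bar>t * b m\<bar>) \<longlongrightarrow> 0) (at 0)" by (auto intro!: tendsto_eq_intros)
    qed
    then show ?thesis by (simp add: LIM_zero_iff)
  qed
  have "((\<lambda>t. (y t)(m := s t)) \<longlongrightarrow> x) (at 0)"
  proof (rule tendsto_fun)
    fix i
    show "((\<lambda>t. ((y t)(m := s t)) i) \<longlongrightarrow> x i) (at 0)"
      by (cases "i = m"; cases "i < m") (auto simp: s_lim y_def intro!: tendsto_eq_intros)
  qed
  then have "(Q \<longlongrightarrow> partial_deriv m F x) (at 0)"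
    unfolding Q_def
    by (rule continuous_on_tendsto_compose[OF smooth_on_continuous[OF smooth_on_partial_deriv[OF F m]]])
      (use x y m in \<open>auto intro!: always_eventually fun_upd_Euclidean_space\<close>)
  then have "((\<lambda>t. b m * Q t) \<longlongrightarrow> partial_deriv m F x * b m) (at 0)"
    by (auto intro!: tendsto_eq_intros)
  moreover have "eventually (\<lambda>t. b m * Q t = (t * b m * Q t - 0 * b m * Q 0) / (t - 0)) (at 0)"
    by (rule eventually_at_filter[THEN iffD2]) auto
  ultimately have "((\<lambda>t. t * b m * Q t) has_real_derivative partial_deriv m F x * b m) (at 0)"
    unfolding has_field_derivative_iff using tendsto_cong by force
  then have "((\<lambda>t. F (y t) + t * b m * Q t) has_real_derivative
      (\<Sum>i<m. partial_deriv i F x * b i) + partial_deriv m F x * b m) (at 0)"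
    using Suc unfolding y_def by (intro DERIV_add) auto
  moreover have "F (y t) + t * b m * Q t = F (\<lambda>i. if i < Suc m then x i + t * b i else x i)" for t
  proof -
    have "(y t)(m := x m + t * b m) = (\<lambda>i. if i < Suc m then x i + t * b i else x i)"
      by (auto simp: y_def)
    then show ?thesis using eq[of t] by (simp add: Q_def)
  qed
  ultimately show ?case by simp
qed auto

section \<open>Symmetry of second derivatives\<close>

lemma second_difference:
  assumes F: "smooth_on k (topspace (Euclidean_space k)) F" and ij: "i < k" "j < k" "i \<noteq> j"
    and x: "x \<in> topspace (Euclidean_space k)"
  shows "\<exists>s r. \<bar>s - x i\<bar> \<le> \<bar>h\<bar> \<and> \<bar>r - x j\<bar> \<le> \<bar>h\<bar> \<and>
    F (x(i := x i + h, j := x j + h)) - F (x(i := x i + h)) - F (x(j := x j + h)) + F x =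
    h * h * partial_deriv j (partial_deriv i F) (x(i := s, j := r))"
proof (cases "h = 0")
  case True
  then show ?thesis by (intro exI[of _ "x i"] exI[of _ "x j"]) auto
next
  case False
  note upd = fun_upd_Euclidean_space
  \<comment> \<open>\<open>\<phi>\<close> is the increment in direction j as a function of the i-th
    coordinate. The mean value theorem for \<open>\<phi>\<close> supplies s; applied to
    \<open>partial_deriv i F\<close> in direction j it then supplies r.\<close>
  define \<phi> where "\<phi> t = F (x(i := t, j := x j + h)) - F (x(i := t))" for t
  define \<phi>' where "\<phi>' t = partial_deriv i F (x(i := t, j := x j + h)) - partial_deriv i F (x(i := t))" for t
  have D: "(\<phi> has_real_derivative \<phi>' t) (at t)" for t
  proof -
    have "((\<lambda>t. F (x(j := x j + h, i := t))) has_real_derivative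
        partial_deriv i F (x(j := x j + h, i := t))) (at t)"
      using smooth_on_has_partial_deriv[OF F ij(1), of "x(j := x j + h, i := t)"] x ij
      by (simp add: upd)
    moreover have "((\<lambda>t. F (x(i := t))) has_real_derivative partial_deriv i F (x(i := t))) (at t)"
      using smooth_on_has_partial_deriv[OF F ij(1), of "x(i := t)"] x ij by (simp add: upd)
    ultimately show ?thesis
      unfolding \<phi>_def \<phi>'_def using ij(3) by (intro DERIV_diff) (simp_all add: fun_upd_twist)
  qed
  have "\<exists>s. \<bar>s - x i\<bar> \<le> \<bar>h\<bar> \<and> \<phi> (x i + h) - \<phi> (x i) = h * \<phi>' s"
  proof (cases "h > 0")
    case True
    from MVT2[of "x i" "x i + h" \<phi> \<phi>'] D True
    obtain z where "x i < z" "z < x i + h" "\<phi> (x i + h) - \<phi> (x i) = (x i + h - x i) * \<phi>' z" by auto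
    then show ?thesis by (intro exI[of _ z]) auto
  next
    case False
    from MVT2[of "x i + h" "x i" \<phi> \<phi>'] D False \<open>h \<noteq> 0\<close>
    obtain z where "x i + h < z" "z < x i" "\<phi> (x i) - \<phi> (x i + h) = (x i - (x i + h)) * \<phi>' z" by auto
    then show ?thesis by (intro exI[of _ z]) auto
  qed
  then obtain s where s: "\<bar>s - x i\<bar> \<le> \<bar>h\<bar>" "\<phi> (x i + h) - \<phi> (x i) = h * \<phi>' s" by auto
  have "x(i := s) \<in> topspace (Euclidean_space k)" using x ij by (simp add: upd)
  from partial_MVT[OF smooth_on_partial_deriv[OF F ij(1)] ij(2) this, of h] ij(3)
  obtain r where r: "\<bar>r - x j\<bar> \<le> \<bar>h\<bar>"
    "\<phi>' s = h * partial_deriv j (partial_deriv i F) (x(i := s, j := r))"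
    unfolding \<phi>'_def by auto
  have "\<phi> (x i + h) - \<phi> (x i) =
      F (x(i := x i + h, j := x j + h)) - F (x(i := x i + h)) - F (x(j := x j + h)) + F x"
    by (simp add: \<phi>_def)
  then show ?thesis using s r by (intro exI[of _ s] exI[of _ r]) simp
qed

text \<open>The intermediate points of \<open>second_difference\<close> are squeezed to x, and the
  mixed derivative is continuous.\<close>

lemma second_difference_limit:
  assumes F: "smooth_on k (topspace (Euclidean_space k)) F" and ij: "i < k" "j < k" "i \<noteq> j"
    and x: "x \<in> topspace (Euclidean_space k)"
  shows "((\<lambda>h. (F (x(i := x i + h, j := x j + h)) - F (x(i := x i + h)) - F (x(j := x j + h)) + F x)
      / (h * h)) \<longlongrightarrow> partial_deriv j (partial_deriv i F) x) (at 0)"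
proof -
  from second_difference[OF assms] obtain s r where
    s: "\<And>h. \<bar>s h - x i\<bar> \<le> \<bar>h\<bar>" and r: "\<And>h. \<bar>r h - x j\<bar> \<le> \<bar>h\<bar>" and
    eq: "\<And>h. F (x(i := x i + h, j := x j + h)) - F (x(i := x i + h)) - F (x(j := x j + h)) + F x =
      h * h * partial_deriv j (partial_deriv i F) (x(i := s h, j := r h))"
    by metis
  have lim: "(f \<longlongrightarrow> c) (at 0)" if "\<And>h. \<bar>f h - c\<bar> \<le> \<bar>h\<bar>" for f :: "real \<Rightarrow> real" and c
  proof -
    have "((\<lambda>t. f t - c) \<longlongrightarrow> 0) (at 0)"
    proof (rule Lim_null_comparison)
      show "\<forall>\<^sub>F t in at 0. norm (f t - c) \<le> \<bar>t\<bar>" using that by auto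
      show "((\<lambda>t::real. \<bar>t\<bar>) \<longlongrightarrow> 0) (at 0)" by (auto intro!: tendsto_eq_intros)
    qed
    then show ?thesis by (simp add: LIM_zero_iff)
  qed
  have "((\<lambda>h. x(i := s h, j := r h)) \<longlongrightarrow> x) (at 0)"
  proof (rule tendsto_fun)
    fix l
    show "((\<lambda>h. (x(i := s h, j := r h)) l) \<longlongrightarrow> x l) (at 0)"
      using lim[OF s] lim[OF r] by (cases "l = j"; cases "l = i") auto
  qed
  then have "((\<lambda>h. partial_deriv j (partial_deriv i F) (x(i := s h, j := r h)))
      \<longlongrightarrow> partial_deriv j (partial_deriv i F) x) (at 0)"
    by (rule continuous_on_tendsto_compose[OF smooth_on_continuous[OF
            smooth_on_partial_deriv[OF smooth_on_partial_deriv[OF F ij(1)] ij(2)]]])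
      (use x ij in \<open>auto intro!: always_eventually fun_upd_Euclidean_space\<close>)
  then show ?thesis
    by (rule Lim_transform_eventually)
      (auto simp: eq eventually_at_filter)
qed

text \<open>The second difference is symmetric in i and j, so the two mixed derivatives are limits
  of the same quotient.\<close>

lemma partial_deriv_commute:
  assumes F: "smooth_on k (topspace (Euclidean_space k)) F" and ij: "i < k" "j < k"
    and x: "x \<in> topspace (Euclidean_space k)"
  shows "partial_deriv j (partial_deriv i F) x = partial_deriv i (partial_deriv j F) x"
proof (cases "i = j")
  case False
  have "((\<lambda>h. (F (x(i := x i + h, j := x j + h)) - F (x(i := x i + h)) - F (x(j := x j + h)) + F x)
      / (h * h)) \<longlongrightarrow> partial_deriv i (partial_deriv j F) x) (at 0)"
    using second_difference_limit[OF F ij(2,1) _ x] False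
    by (simp add: fun_upd_twist algebra_simps)
  with second_difference_limit[OF F ij False x] show ?thesis
    using tendsto_unique trivial_limit_at by blast
qed simp


section \<open>Linear algebra and tensor products\<close>

lemma sum_fun_apply: "(\<Sum>i\<in>I. f i) x = (\<Sum>i\<in>I. f i x)"
  for f :: "'i \<Rightarrow> 'a \<Rightarrow> 'b::comm_monoid_add"
  by (induction I rule: infinite_finite_induct) auto

text \<open>Dependence is stated for the family and not for the set \<open>range v\<close>: a
  repeated vector makes the family dependent while the range may stay independent. Hence the split
  on \<open>inj v\<close>; in the injective case an infinite set inside a finitely generated span is
  dependent.\<close>

lemma span_finite_sequence_dependence:
  fixes v :: "nat \<Rightarrow> 'a::real_vector"
  assumes "finite Q" "\<And>j. v j \<in> span Q"
  obtains n c where "\<exists>j\<le>n. c j \<noteq> 0" "(\<Sum>j\<le>n. c j *\<^sub>R v j) = 0"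
proof (cases "inj v")
  case False
  then obtain i j where ij: "i < j" "v i = v j"
    by (metis injI linorder_neqE_nat)
  let ?c = "\<lambda>l. (if l = i then 1 else 0) - (if l = j then 1 else 0 :: real)"
  have "(\<Sum>l\<le>j. ?c l *\<^sub>R v l) = (\<Sum>l\<le>j. if l = i then v l else 0) - (\<Sum>l\<le>j. if l = j then v l else 0)"
    unfolding sum_subtractf[symmetric] by (intro sum.cong) auto
  also have "\<dots> = 0" using ij by simp
  finally show thesis
    using ij by (intro that[of j ?c]) auto
next
  case True
  then have "infinite (range v)" by (rule range_inj_infinite)
  then have "dependent (range v)"
    using independent_span_bound[OF assms(1), of "range v"] assms(2) by auto
  then obtain t u where t: "finite t" "t \<subseteq> range v" "(\<Sum>w\<in>t. u w *\<^sub>R w) = 0" "\<exists>w\<in>t. u w \<noteq> 0"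
    unfolding dependent_explicit by auto
  define J where "J = v -` t"
  have J: "finite J" unfolding J_def using t(1) True by (rule finite_vimageI)
  define c where "c j = (if j \<in> J then u (v j) else 0)" for j
  have "(\<Sum>j\<le>Max J. c j *\<^sub>R v j) = (\<Sum>j\<in>J. u (v j) *\<^sub>R v j)"
    using J by (intro sum.mono_neutral_cong_right) (auto simp: c_def)
  also have "\<dots> = (\<Sum>w\<in>v ` J. u w *\<^sub>R w)"
    using True by (subst sum.reindex) (auto intro: inj_on_subset)
  also have "v ` J = t" using t(2) by (auto simp: J_def)
  finally have "(\<Sum>j\<le>Max J. c j *\<^sub>R v j) = 0" using t(3) by simp
  moreover obtain w where "w \<in> t" "u w \<noteq> 0" using t(4) by auto
  then obtain j where "j \<in> J" "c j \<noteq> 0" using t(2) by (auto simp: J_def c_def)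
  moreover have "j \<le> Max J" using J \<open>j \<in> J\<close> by simp
  ultimately show thesis by (intro that[of "Max J" c]) auto
qed

text \<open>A linear relation among the powers is a polynomial equation satisfied by every value of
  g. Its finitely many roots leave a finite range, and a nonempty connected finite set of reals is a
  point.\<close>

lemma powers_in_finite_span_imp_constant:
  fixes g :: "'a::topological_space \<Rightarrow> real"
  assumes "connected (UNIV :: 'a set)" "continuous_on UNIV g"
    and "finite Q" "\<And>j. (\<lambda>x. g x ^ Suc j) \<in> span Q"
  obtains c where "g = (\<lambda>_. c)"
proof -
  obtain n c where c: "\<exists>j\<le>n. c j \<noteq> 0" "(\<Sum>j\<le>n. c j *\<^sub>R (\<lambda>x. g x ^ Suc j)) = 0"
    using span_finite_sequence_dependence[OF assms(3,4)] .
  \<comment> \<open>The exponents start at 1, so one factor \<open>g x\<close> splits off, and 0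
    joins the roots of the remaining polynomial.\<close>
  have "g x \<in> insert 0 {z. (\<Sum>j\<le>n. c j * z ^ j) = 0}" for x
  proof -
    have "(\<Sum>j\<le>n. c j *\<^sub>R (\<lambda>x. g x ^ Suc j)) x = 0" using c(2) by simp
    then have "g x * (\<Sum>j\<le>n. c j * g x ^ j) = 0"
      by (simp add: sum_fun_apply scaleR_fun_def sum_distrib_left algebra_simps)
    then show ?thesis by auto
  qed
  moreover have "finite {z. (\<Sum>j\<le>n. c j * z ^ j) = 0}"
    using c(1) by (simp add: polyfun_finite_roots)
  ultimately have "finite (range g)"
    by (meson finite_insert finite_subset image_subsetI)
  moreover have "connected (range g)"
    using connected_continuous_image[OF assms(2,1)] .
  ultimately obtain a where "range g = {a}"
    using connected_finite_iff_sing by blast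
  then have "g = (\<lambda>_. a)" by auto
  then show thesis by (rule that)
qed

section \<open>The free vector space on pairs\<close>

lemma lookup_scaleR: "Poly_Mapping.lookup (c *\<^sub>R p) x = c *\<^sub>R Poly_Mapping.lookup p x"
  for p :: "('a, 'b::real_vector) poly_mapping"
proof -
  have "{x. c *\<^sub>R Poly_Mapping.lookup p x \<noteq> 0} \<subseteq> Poly_Mapping.keys p"
    by (auto simp: in_keys_iff)
  then have "finite {x. c *\<^sub>R Poly_Mapping.lookup p x \<noteq> 0}"
    by (rule finite_subset) simp
  then show ?thesis by (simp add: scaleR_poly_mapping_def lookup_Abs_poly_mapping)
qed

lemma keys_scaleR: "Poly_Mapping.keys (c *\<^sub>R p) \<subseteq> Poly_Mapping.keys p"
  for p :: "('a, 'b::real_vector) poly_mapping"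
  by (auto simp: in_keys_iff lookup_scaleR)

lemma single_eq_scaleR_pure: "Poly_Mapping.single (a, b) c = c *\<^sub>R pure a b"
  by (rule poly_mapping_eqI) (simp add: lookup_scaleR lookup_single when_def)

lemma poly_mapping_eq_sum_single:
  "p = (\<Sum>k\<in>Poly_Mapping.keys p. Poly_Mapping.single k (Poly_Mapping.lookup p k))"
proof (rule poly_mapping_eqI)
  fix x
  show "Poly_Mapping.lookup p x =
      Poly_Mapping.lookup (\<Sum>k\<in>Poly_Mapping.keys p. Poly_Mapping.single k (Poly_Mapping.lookup p k)) x"
    by (simp add: lookup_sum lookup_single when_def in_keys_iff)
qed

text \<open>The inclusions of keys are carried through the induction because the laws to be proved
  hold for cylinder functions and vector fields only, not for arbitrary pairs.\<close>

lemma poly_mapping_pure_induct [consumes 1, case_names zero pure add]: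
  fixes p :: "('a \<times> 'b, real) poly_mapping"
  assumes keys: "Poly_Mapping.keys p \<subseteq> S \<times> T"
    and zero: "P 0"
    and pure: "\<And>c a b. a \<in> S \<Longrightarrow> b \<in> T \<Longrightarrow> P (c *\<^sub>R pure a b)"
    and add: "\<And>p q. Poly_Mapping.keys p \<subseteq> S \<times> T \<Longrightarrow> Poly_Mapping.keys q \<subseteq> S \<times> T \<Longrightarrow>
      P p \<Longrightarrow> P q \<Longrightarrow> P (p + q)"
  shows "P p"
proof -
  let ?s = "\<lambda>K. \<Sum>k\<in>K. Poly_Mapping.single k (Poly_Mapping.lookup p k)"
  have "P (?s K) \<and> Poly_Mapping.keys (?s K) \<subseteq> S \<times> T" if "finite K" "K \<subseteq> S \<times> T" for K
    using that
  proof (induction K rule: finite_induct)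
    case (insert k K)
    obtain a b where k: "k = (a, b)" "a \<in> S" "b \<in> T" using insert.prems by auto
    have *: "Poly_Mapping.keys (Poly_Mapping.single k (Poly_Mapping.lookup p k)) \<subseteq> S \<times> T"
      using k by auto
    have "P (Poly_Mapping.single k (Poly_Mapping.lookup p k))"
      unfolding k(1) by (subst single_eq_scaleR_pure) (rule pure[OF k(2,3)])
    have IH: "P (?s K)" "Poly_Mapping.keys (?s K) \<subseteq> S \<times> T"
      using insert.IH insert.prems by blast+
    from \<open>P (Poly_Mapping.single k _)\<close> IH(1)
    have "P (Poly_Mapping.single k (Poly_Mapping.lookup p k) + ?s K)"
      by (rule add[OF * IH(2)])
    moreover have "Poly_Mapping.keys (Poly_Mapping.single k (Poly_Mapping.lookup p k) + ?s K) \<subseteq> S \<times> T"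
      using keys_add[of "Poly_Mapping.single k (Poly_Mapping.lookup p k)" "?s K"] * IH(2) by blast
    ultimately show ?case unfolding sum.insert[OF insert.hyps] by blast
  qed (auto intro: zero)
  from this[OF finite_keys keys] show ?thesis
    using poly_mapping_eq_sum_single[of p] by simp
qed

lemma linear_ext_superset:
  assumes "finite K" "Poly_Mapping.keys p \<subseteq> K"
  shows "linear_ext \<beta> p = (\<Sum>(a, b)\<in>K. Poly_Mapping.lookup p (a, b) *\<^sub>R \<beta> a b)"
  unfolding linear_ext_def
  by (rule sum.mono_neutral_left) (use assms in \<open>auto simp: in_keys_iff\<close>)

lemma linear_ext_add: "linear_ext \<beta> (p + q) = linear_ext \<beta> p + linear_ext \<beta> q"
proof -
  let ?K = "Poly_Mapping.keys p \<union> Poly_Mapping.keys q"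
  have "Poly_Mapping.keys (p + q) \<subseteq> ?K" by (rule keys_add)
  then show ?thesis
    by (subst (1 2 3) linear_ext_superset[of ?K])
      (auto simp: lookup_add scaleR_add_left case_prod_beta sum.distrib)
qed

lemma linear_ext_scale: "linear_ext \<beta> (c *\<^sub>R p) = c *\<^sub>R linear_ext \<beta> p"
  by (subst (1 2) linear_ext_superset[of "Poly_Mapping.keys p"])
    (auto simp: keys_scaleR lookup_scaleR case_prod_beta scaleR_sum_right)

lemma linear_linear_ext: "linear (linear_ext \<beta>)"
  by (intro linearI linear_ext_add linear_ext_scale)

lemma linear_ext_pure: "linear_ext \<beta> (pure a b) = \<beta> a b"
  by (simp add: linear_ext_def)

lemma keys_pure: "a \<in> S \<Longrightarrow> b \<in> T \<Longrightarrow> Poly_Mapping.keys (pure a b) \<subseteq> S \<times> T"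
  by simp

section \<open>Bilinear maps and the tensor relations\<close>

definition bilinear_on ::
  "'a::real_vector set \<Rightarrow> 'b::real_vector set \<Rightarrow> ('a \<Rightarrow> 'b \<Rightarrow> 'c::real_vector) \<Rightarrow> bool"
  where "bilinear_on S T \<beta> \<longleftrightarrow>
    (\<forall>a\<in>S. \<forall>a'\<in>S. \<forall>b\<in>T. \<beta> (a + a') b = \<beta> a b + \<beta> a' b) \<and>
    (\<forall>a\<in>S. \<forall>b\<in>T. \<forall>b'\<in>T. \<beta> a (b + b') = \<beta> a b + \<beta> a b') \<and>
    (\<forall>a\<in>S. \<forall>b\<in>T. \<forall>c. \<beta> (c *\<^sub>R a) b = c *\<^sub>R \<beta> a b \<and> \<beta> a (c *\<^sub>R b) = c *\<^sub>R \<beta> a b)"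

text \<open>One half of the universal property: the kernel of the linear extension is a subspace
  that contains the generating relations. Values computed from a representative therefore depend on
  its coset only.\<close>

lemma linear_ext_null:
  assumes "bilinear_on S T \<beta>" "p \<in> tensor_null S T"
  shows "linear_ext \<beta> p = 0"
proof -
  interpret linear "linear_ext \<beta>" by (rule linear_linear_ext)
  have "subspace {p. linear_ext \<beta> p = 0}" by (auto intro: subspaceI simp: zero add scale)
  then have "tensor_null S T \<subseteq> {p. linear_ext \<beta> p = 0}"
    unfolding tensor_null_def
    by (rule span_minimal[rotated])
      (use assms(1) in \<open>auto simp: bilinear_on_def diff scale linear_ext_pure\<close>)
  with assms(2) show ?thesis by auto
qed

lemma subspace_tensor_null: "subspace (tensor_null S T)"
  by (simp add: tensor_null_def)

lemma tensor_null_add_left: "a \<in> S \<Longrightarrow> a' \<in> S \<Longrightarrow> b \<in> T \<Longrightarrow>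
    pure (a + a') b - pure a b - pure a' b \<in> tensor_null S T"
  and tensor_null_add_right: "a \<in> S \<Longrightarrow> b \<in> T \<Longrightarrow> b' \<in> T \<Longrightarrow>
    pure a (b + b') - pure a b - pure a b' \<in> tensor_null S T"
  and tensor_null_scale_left: "a \<in> S \<Longrightarrow> b \<in> T \<Longrightarrow>
    pure (c *\<^sub>R a) b - c *\<^sub>R pure a b \<in> tensor_null S T"
  and tensor_null_scale_right: "a \<in> S \<Longrightarrow> b \<in> T \<Longrightarrow>
    pure a (c *\<^sub>R b) - c *\<^sub>R pure a b \<in> tensor_null S T"
  unfolding tensor_null_def by (rule span_base; blast)+

text \<open>Meant for maps into the free space itself, such as multiplication by a cylinder
  function. They send relations to relations rather than to 0, out of reach of
  \<open>linear_ext_null\<close>.\<close>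

lemma tensor_null_least:
  assumes "subspace W"
    and "\<And>a a' b. a \<in> S \<Longrightarrow> a' \<in> S \<Longrightarrow> b \<in> T \<Longrightarrow> pure (a + a') b - pure a b - pure a' b \<in> W"
    and "\<And>a b b'. a \<in> S \<Longrightarrow> b \<in> T \<Longrightarrow> b' \<in> T \<Longrightarrow> pure a (b + b') - pure a b - pure a b' \<in> W"
    and "\<And>c a b. a \<in> S \<Longrightarrow> b \<in> T \<Longrightarrow> pure (c *\<^sub>R a) b - c *\<^sub>R pure a b \<in> W"
    and "\<And>c a b. a \<in> S \<Longrightarrow> b \<in> T \<Longrightarrow> pure a (c *\<^sub>R b) - c *\<^sub>R pure a b \<in> W"
  shows "tensor_null S T \<subseteq> W"
  unfolding tensor_null_def
  by (intro span_minimal[OF _ assms(1)] Un_least subsetI; elim CollectE exE conjE;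
      simp only: assms(2-5))

section \<open>Cosets and normal forms of tensors\<close>

lemma tensor_coset_eq_iff:
  "tensor_coset S T p = tensor_coset S T q \<longleftrightarrow> p - q \<in> tensor_null S T"
proof
  assume "tensor_coset S T p = tensor_coset S T q"
  moreover have "p \<in> tensor_coset S T p"
    using subspace_0[OF subspace_tensor_null] by (auto simp: tensor_coset_def)
  ultimately show "p - q \<in> tensor_null S T" by (auto simp: tensor_coset_def)
next
  assume *: "p - q \<in> tensor_null S T"
  have "r - p \<in> tensor_null S T \<longleftrightarrow> r - q \<in> tensor_null S T" for r
    using subspace_add[OF subspace_tensor_null, of "r - p" S T "p - q"]
      subspace_diff[OF subspace_tensor_null, of "r - q" S T "p - q"] * by auto
  then show "tensor_coset S T p = tensor_coset S T q" by (auto simp: tensor_coset_def)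
qed

lemma tensor_coset_self: "p \<in> tensor_coset S T p"
  using subspace_0[OF subspace_tensor_null] by (auto simp: tensor_coset_def)

text \<open>The union over all representatives is a union of one and the same coset.\<close>

lemma tensor_add_coset:
  "tensor_add S T (tensor_coset S T p) (tensor_coset S T q) = tensor_coset S T (p + q)"
proof -
  have "tensor_coset S T (p' + q') = tensor_coset S T (p + q)"
    if "p' \<in> tensor_coset S T p" "q' \<in> tensor_coset S T q" for p' q'
    unfolding tensor_coset_eq_iff
    using that subspace_add[OF subspace_tensor_null, of "p' - p" S T "q' - q"]
    by (simp add: tensor_coset_def add_diff_add)
  moreover have "tensor_coset S T p \<noteq> {}" for p using tensor_coset_self by blast
  ultimately show ?thesis
    unfolding tensor_add_def by (intro SUP_eq_const) simp_all
qed

lemma tensor_scale_coset: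
  "tensor_scale S T c (tensor_coset S T p) = tensor_coset S T (c *\<^sub>R p)"
proof -
  have "tensor_coset S T (c *\<^sub>R p') = tensor_coset S T (c *\<^sub>R p)"
    if "p' \<in> tensor_coset S T p" for p'
    unfolding tensor_coset_eq_iff
    using that subspace_scale[OF subspace_tensor_null, of "p' - p" S T c]
    by (simp add: tensor_coset_def scaleR_diff_right)
  then show ?thesis
    unfolding tensor_scale_def using tensor_coset_self by (intro SUP_eq_const) blast+
qed

lemma pure_sum_right_null:
  assumes S: "subspace S" and T: "subspace T" and a: "a \<in> S" and "finite I" "I \<subseteq> T"
  shows "pure a (\<Sum>e\<in>I. r e *\<^sub>R e) - (\<Sum>e\<in>I. pure (r e *\<^sub>R a) e) \<in> tensor_null S T"
  using assms(4,5)
proof (induction I rule: finite_induct)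
  case empty
  then show ?case
    using tensor_null_scale_right[OF a subspace_0[OF T], of 0] by simp
next
  case (insert e I)
  let ?y = "\<Sum>e\<in>I. r e *\<^sub>R e"
  have e: "e \<in> T" "r e *\<^sub>R e \<in> T" "?y \<in> T"
    using insert.prems by (auto intro!: subspace_sum subspace_scale T)
  note N = subspace_tensor_null[of S T]
  have IH: "pure a ?y - (\<Sum>e\<in>I. pure (r e *\<^sub>R a) e) \<in> tensor_null S T"
    using insert by simp
  \<comment> \<open>Additivity in the second factor, the scalar pulled out on the right and pushed
    in on the left, and the induction hypothesis add up to the claim.\<close>
  have "(pure a (r e *\<^sub>R e + ?y) - pure a (r e *\<^sub>R e) - pure a ?y) +
      (pure a (r e *\<^sub>R e) - r e *\<^sub>R pure a e) - (pure (r e *\<^sub>R a) e - r e *\<^sub>R pure a e) +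
      (pure a ?y - (\<Sum>e\<in>I. pure (r e *\<^sub>R a) e)) \<in> tensor_null S T"
    by (rule subspace_add[OF N subspace_diff[OF N subspace_add[OF N tensor_null_add_right[OF a e(2,3)]
            tensor_null_scale_right[OF a e(1)]] tensor_null_scale_left[OF a e(1)]] IH])
  then show ?case using insert.hyps by (simp add: algebra_simps)
qed

text \<open>A normal form with a single coefficient for each vector of B. When B is independent,
  this is the form in which coefficients can be compared with 0.\<close>

lemma tensor_reduce_basis:
  assumes S: "subspace S" and T: "subspace T" and B: "finite B" "B \<subseteq> T"
    and p: "Poly_Mapping.keys p \<subseteq> S \<times> span B"
  shows "\<exists>u. (\<forall>b\<in>B. u b \<in> S) \<and> p - (\<Sum>b\<in>B. pure (u b) b) \<in> tensor_null S T"
  using p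
proof (induction rule: poly_mapping_pure_induct)
  case zero
  have "pure 0 b \<in> tensor_null S T" if "b \<in> B" for b
    using tensor_null_scale_left[OF subspace_0[OF S], of b T 0] that B by auto
  then have "0 - (\<Sum>b\<in>B. pure 0 b) \<in> tensor_null S T"
    by (intro subspace_diff[OF subspace_tensor_null] subspace_sum[OF subspace_tensor_null]
        subspace_0[OF subspace_tensor_null])
  then show ?case using subspace_0[OF S] by (intro exI[of _ "\<lambda>_. 0"]) auto
next
  case (pure c a b)
  obtain r where r: "b = (\<Sum>e\<in>B. r e *\<^sub>R e)"
    using pure(2) unfolding span_finite[OF B(1)] by auto
  have bT: "b \<in> T" using pure(2) span_minimal[OF B(2) T] by auto
  have ca: "c *\<^sub>R a \<in> S" using pure(1) S by (rule subspace_scale[rotated])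
  have "(pure (c *\<^sub>R a) b - (\<Sum>e\<in>B. pure (r e *\<^sub>R c *\<^sub>R a) e)) - (pure (c *\<^sub>R a) b - c *\<^sub>R pure a b)
      \<in> tensor_null S T"
    using pure_sum_right_null[OF S T ca B, of r] tensor_null_scale_left[OF pure(1) bT, of c]
    unfolding r[symmetric] by (rule subspace_diff[OF subspace_tensor_null])
  then have "c *\<^sub>R pure a b - (\<Sum>e\<in>B. pure (r e *\<^sub>R c *\<^sub>R a) e) \<in> tensor_null S T"
    by simp
  then show ?case
    by (intro exI[of _ "\<lambda>e. r e *\<^sub>R c *\<^sub>R a"] conjI ballI subspace_scale[OF S ca])
next
  case (add p q)
  then obtain u v where u: "\<forall>b\<in>B. u b \<in> S" "p - (\<Sum>b\<in>B. pure (u b) b) \<in> tensor_null S T"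
    and v: "\<forall>b\<in>B. v b \<in> S" "q - (\<Sum>b\<in>B. pure (v b) b) \<in> tensor_null S T"
    by blast
  have "(\<Sum>b\<in>B. pure (u b + v b) b - pure (u b) b - pure (v b) b) \<in> tensor_null S T"
    using u(1) v(1) B by (intro subspace_sum[OF subspace_tensor_null] tensor_null_add_left) auto
  then have "(p - (\<Sum>b\<in>B. pure (u b) b)) + (q - (\<Sum>b\<in>B. pure (v b) b)) -
      (\<Sum>b\<in>B. pure (u b + v b) b - pure (u b) b - pure (v b) b) \<in> tensor_null S T"
    by (rule subspace_diff[OF subspace_tensor_null subspace_add[OF subspace_tensor_null u(2) v(2)]])
  then have "p + q - (\<Sum>b\<in>B. pure (u b + v b) b) \<in> tensor_null S T"
    by (simp add: sum_subtractf add_diff_eq)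
  then show ?case
    using u(1) v(1) by (intro exI[of _ "\<lambda>b. u b + v b"]) (simp add: subspace_add[OF S])
qed

lemma keys_scaleR_subset: "Poly_Mapping.keys p \<subseteq> K \<Longrightarrow> Poly_Mapping.keys (c *\<^sub>R p) \<subseteq> K"
  for p :: "('a, 'b::real_vector) poly_mapping"
  using keys_scaleR[of c p] by blast

lemma keys_add_subset: "Poly_Mapping.keys p \<subseteq> K \<Longrightarrow> Poly_Mapping.keys q \<subseteq> K \<Longrightarrow>
    Poly_Mapping.keys (p + q) \<subseteq> K"
  using keys_add[of p q] by blast


section \<open>Smooth functions and vector fields on a closed manifold\<close>

text \<open>Compactness makes smooth functions bounded, hence integrable against every probability
  measure. Connectedness makes smooth functions with finite range constant.\<close>

locale closed_manifold =
  fixes d :: nat and A :: "('m::topological_space) chart set"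
  assumes atlas: "smooth_atlas d A"
    and compact: "compact (UNIV :: 'm set)"
    and connected: "connected (UNIV :: 'm set)"
begin

abbreviation "\<C> \<equiv> smooth_functions d A"
abbreviation "\<X> \<equiv> vector_fields d A"
abbreviation "\<F> \<equiv> cyl_functions d A"

lemma coord_open_chart: "(U, \<phi>) \<in> A \<Longrightarrow> coord_open d (\<phi> ` U)"
  using atlas by (auto simp: smooth_atlas_def is_chart_def intro!: coord_open_openin)

lemma smooth_const: "(\<lambda>x. c) \<in> \<C>"
  using coord_open_chart by (auto simp: smooth_functions_def comp_def intro!: smooth_on_const)

lemma smooth_add: "f \<in> \<C> \<Longrightarrow> g \<in> \<C> \<Longrightarrow> f + g \<in> \<C>"
  using coord_open_chart
  by (fastforce simp: smooth_functions_def comp_def intro!: smooth_on_add)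

lemma smooth_mult: "f \<in> \<C> \<Longrightarrow> g \<in> \<C> \<Longrightarrow> f * g \<in> \<C>"
  using coord_open_chart
  by (fastforce simp: smooth_functions_def comp_def intro!: smooth_on_mult)

lemma smooth_scale: "f \<in> \<C> \<Longrightarrow> c *\<^sub>R f \<in> \<C>"
  using smooth_mult[OF smooth_const[of c], of f] by (simp add: times_fun_def scaleR_fun_def)

lemma smooth_diff: "f \<in> \<C> \<Longrightarrow> g \<in> \<C> \<Longrightarrow> f - g \<in> \<C>"
  using smooth_add[of f "(-1) *\<^sub>R g"] smooth_scale[of g "-1"] by simp

lemma smooth_sum: "(\<And>i. i \<in> I \<Longrightarrow> f i \<in> \<C>) \<Longrightarrow> (\<Sum>i\<in>I. f i) \<in> \<C>"
proof (induction I rule: infinite_finite_induct)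
  case (insert i I)
  then show ?case by (simp add: smooth_add del: plus_fun_apply)
qed (use smooth_const[of 0] in \<open>simp_all add: zero_fun_def\<close>)

lemma smooth_continuous:
  assumes "f \<in> \<C>"
  shows "continuous_on UNIV f"
proof -
  have "continuous_on (\<Union>c\<in>A. fst c) f"
  proof (rule continuous_on_open_UN)
    fix c assume c: "c \<in> A"
    obtain U \<phi> where U: "c = (U, \<phi>)" by (cases c)
    have chart: "open U" "homeomorphism U (\<phi> ` U) \<phi> (inv_into U \<phi>)"
      using atlas c by (auto simp: U smooth_atlas_def is_chart_def)
    then show "open (fst c)" by (simp add: U)
    have "smooth_on d (\<phi> ` U) (f \<circ> inv_into U \<phi>)"
      using assms c by (auto simp: U smooth_functions_def)
    then have "continuous_on (\<phi> ` U) (f \<circ> inv_into U \<phi>)" by (rule smooth_on_continuous)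
    then have "continuous_on U (f \<circ> inv_into U \<phi> \<circ> \<phi>)"
      using chart(2) by (intro continuous_on_compose[of U \<phi> "f \<circ> inv_into U \<phi>"]) (auto simp: homeomorphism_def)
    moreover have "(f \<circ> inv_into U \<phi> \<circ> \<phi>) x = f x" if "x \<in> U" for x
      using chart(2) that by (auto simp: homeomorphism_def)
    ultimately show "continuous_on (fst c) f"
      unfolding U fst_conv by (rule continuous_on_eq)
  qed
  then show ?thesis using atlas by (simp add: smooth_atlas_def)
qed

section \<open>Derivations at a point and vector fields\<close>

lemma tangent_add: "\<xi> \<in> tangent_space d A x \<Longrightarrow> f \<in> \<C> \<Longrightarrow> g \<in> \<C> \<Longrightarrow> \<xi> (f + g) = \<xi> f + \<xi> g"
  and tangent_mult: "\<xi> \<in> tangent_space d A x \<Longrightarrow> f \<in> \<C> \<Longrightarrow> g \<in> \<C> \<Longrightarrow>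
    \<xi> (f * g) = f x * \<xi> g + g x * \<xi> f"
  and tangent_scale: "\<xi> \<in> tangent_space d A x \<Longrightarrow> f \<in> \<C> \<Longrightarrow> \<xi> (c *\<^sub>R f) = c * \<xi> f"
  and tangent_not_smooth: "\<xi> \<in> tangent_space d A x \<Longrightarrow> f \<notin> \<C> \<Longrightarrow> \<xi> f = 0"
  by (auto simp: tangent_space_def)

lemma tangent_const: "\<xi> \<in> tangent_space d A x \<Longrightarrow> \<xi> (\<lambda>_. c) = 0"
proof -
  assume \<xi>: "\<xi> \<in> tangent_space d A x"
  have "\<xi> (\<lambda>_. 1) = 0"
    using tangent_mult[OF \<xi> smooth_const[of 1] smooth_const[of 1]] by (simp add: times_fun_def)
  then show ?thesis
    using tangent_scale[OF \<xi> smooth_const[of 1], of c] by (simp add: scaleR_fun_def)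
qed

lemma tangent_sum:
  assumes "\<xi> \<in> tangent_space d A x" "\<And>i. i \<in> I \<Longrightarrow> f i \<in> \<C>"
  shows "\<xi> (\<Sum>i\<in>I. f i) = (\<Sum>i\<in>I. \<xi> (f i))"
  using assms(2)
proof (induction I rule: infinite_finite_induct)
  case (insert i I)
  then show ?case using assms(1) by (simp add: tangent_add smooth_sum del: plus_fun_apply)
qed (use tangent_const[OF assms(1), of 0] in \<open>simp_all add: zero_fun_def\<close>)

lemma vector_field_tangent: "w \<in> \<X> \<Longrightarrow> w x \<in> tangent_space d A x"
  and vector_field_smooth: "w \<in> \<X> \<Longrightarrow> f \<in> \<C> \<Longrightarrow> (\<lambda>x. w x f) \<in> \<C>"
  by (auto simp: vector_fields_def)

lemma subspace_vector_fields: "subspace \<X>"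
proof (rule subspaceI)
  show "0 \<in> \<X>"
    using smooth_const[of 0] by (auto simp: vector_fields_def tangent_space_def)
next
  fix w z assume *: "w \<in> \<X>" "z \<in> \<X>"
  have "(\<lambda>x. (w + z) x f) \<in> \<C>" if "f \<in> \<C>" for f
    using smooth_add[OF vector_field_smooth[OF *(1) that] vector_field_smooth[OF *(2) that]]
    by (simp add: plus_fun_def)
  then show "w + z \<in> \<X>"
    using * by (auto simp: vector_fields_def tangent_space_def algebra_simps)
next
  fix c w assume *: "w \<in> \<X>"
  have "(\<lambda>x. (c *\<^sub>R w) x f) \<in> \<C>" if "f \<in> \<C>" for f
    using smooth_scale[OF vector_field_smooth[OF * that], of c]
    by (simp add: scaleR_fun_def)
  then show "c *\<^sub>R w \<in> \<X>"
    using * by (auto simp: vector_fields_def tangent_space_def scaleR_fun_def algebra_simps)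
qed

text \<open>The value 0 off \<open>\<C>\<close> is forced by \<open>tangent_space\<close>, whose
  elements vanish there.\<close>

definition vf_bracket :: "'m vfield \<Rightarrow> 'm vfield \<Rightarrow> 'm vfield"
  where "vf_bracket w z x f =
    (if f \<in> \<C> then w x (\<lambda>y. z y f) - z x (\<lambda>y. w y f) else 0)"

text \<open>In the Leibniz rule both orders of composition produce the cross terms
  \<open>(w f) (z g) + (w g) (z f)\<close>, which cancel.\<close>

lemma vf_bracket_in:
  assumes w: "w \<in> \<X>" and z: "z \<in> \<X>"
  shows "vf_bracket w z \<in> \<X>"
proof -
  note wt = vector_field_tangent[OF w] and zt = vector_field_tangent[OF z]
  note ws = vector_field_smooth[OF w] and zs = vector_field_smooth[OF z]
  have add: "(\<lambda>y. v y (f + g)) = (\<lambda>y. v y f) + (\<lambda>y. v y g)"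
    and mult: "(\<lambda>y. v y (f * g)) = f * (\<lambda>y. v y g) + g * (\<lambda>y. v y f)"
    and scale: "(\<lambda>y. v y (c *\<^sub>R f)) = c *\<^sub>R (\<lambda>y. v y f)"
    if "v \<in> \<X>" "f \<in> \<C>" "g \<in> \<C>" for v f g c
    using that(2,3) tangent_add[OF vector_field_tangent[OF that(1)]]
      tangent_mult[OF vector_field_tangent[OF that(1)]] tangent_scale[OF vector_field_tangent[OF that(1)]]
    by (auto simp: fun_eq_iff scaleR_fun_def)
  have "vf_bracket w z x \<in> tangent_space d A x" for x
  proof -
    have "vf_bracket w z x (f + g) = vf_bracket w z x f + vf_bracket w z x g"
      if "f \<in> \<C>" "g \<in> \<C>" for f g
      using that
      by (simp only: vf_bracket_def smooth_add if_True add[OF w that] add[OF z that]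
          tangent_add[OF wt zs zs] tangent_add[OF zt ws ws]
          algebra_simps)
    moreover have "vf_bracket w z x (f * g) = f x * vf_bracket w z x g + g x * vf_bracket w z x f"
      if "f \<in> \<C>" "g \<in> \<C>" for f g
      using that
      by (simp only: vf_bracket_def smooth_mult if_True mult[OF w that] mult[OF z that]
          tangent_add[OF wt smooth_mult[OF that(1) zs[OF that(2)]] smooth_mult[OF that(2) zs[OF that(1)]]]
          tangent_add[OF zt smooth_mult[OF that(1) ws[OF that(2)]] smooth_mult[OF that(2) ws[OF that(1)]]]
          tangent_mult[OF wt that(1) zs[OF that(2)]] tangent_mult[OF wt that(2) zs[OF that(1)]]
          tangent_mult[OF zt that(1) ws[OF that(2)]] tangent_mult[OF zt that(2) ws[OF that(1)]]
          algebra_simps)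
    moreover have "vf_bracket w z x (c *\<^sub>R f) = c * vf_bracket w z x f"
      if "f \<in> \<C>" for f c
      using that
      by (simp only: vf_bracket_def smooth_scale if_True scale[OF w that that] scale[OF z that that]
          tangent_scale[OF wt zs[OF that]] tangent_scale[OF zt ws[OF that]] algebra_simps)
    ultimately show ?thesis by (auto simp: tangent_space_def vf_bracket_def)
  qed
  moreover have "(\<lambda>x. vf_bracket w z x f) \<in> \<C>" if "f \<in> \<C>" for f
    using smooth_diff[OF ws[OF zs[OF that]] zs[OF ws[OF that]]] that
    by (simp add: vf_bracket_def fun_diff_def)
  ultimately show ?thesis by (auto simp: vector_fields_def)
qed

section \<open>Integration against probability measures\<close>

lemma prob_space_measure: "prob_space (measure_of_prob \<mu>)"
  and sets_measure: "sets (measure_of_prob \<mu>) = sets borel"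
  for \<mu> :: "'m borel_prob"
  using measure_of_prob[of \<mu>] by auto

lemma smooth_bounded:
  assumes "f \<in> \<C>"
  obtains B where "\<And>x. \<bar>f x\<bar> \<le> B"
proof -
  have "bounded (range f)"
    using compact_continuous_image[OF smooth_continuous[OF assms] compact] by (rule compact_imp_bounded)
  then show thesis using that by (auto simp: bounded_iff)
qed

lemma smooth_borel_measurable: "f \<in> \<C> \<Longrightarrow> f \<in> borel_measurable borel"
  using smooth_continuous by (simp add: borel_measurable_continuous_onI)

lemma smooth_integrable:
  assumes "f \<in> \<C>"
  shows "integrable (measure_of_prob \<mu>) f"
proof -
  interpret prob_space "measure_of_prob \<mu>" by (rule prob_space_measure)
  obtain B where "\<And>x. \<bar>f x\<bar> \<le> B" using smooth_bounded[OF assms] by blast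
  moreover have "f \<in> borel_measurable (measure_of_prob \<mu>)"
    using smooth_borel_measurable[OF assms] by (simp add: measurable_cong_sets[OF sets_measure refl])
  ultimately show ?thesis by (intro integrable_const_bound[where B=B]) auto
qed

lemma star_add: "f \<in> \<C> \<Longrightarrow> g \<in> \<C> \<Longrightarrow> star (f + g) \<mu> = star f \<mu> + star g \<mu>"
  unfolding star_def by (simp add: plus_fun_def fun_diff_def smooth_integrable)

lemma star_diff: "f \<in> \<C> \<Longrightarrow> g \<in> \<C> \<Longrightarrow> star (f - g) \<mu> = star f \<mu> - star g \<mu>"
  unfolding star_def by (simp add: plus_fun_def fun_diff_def smooth_integrable)

lemma star_scale: "star (c *\<^sub>R f) \<mu> = c * star f \<mu>"
  unfolding star_def by (simp add: scaleR_fun_def)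

text \<open>The measure \<open>(1 - t) \<mu> + t \<delta>\<^sub>x\<close>.\<close>

definition toward_point :: "'m borel_prob \<Rightarrow> 'm \<Rightarrow> real \<Rightarrow> 'm borel_prob"
  where "toward_point \<mu> x t = Abs_borel_prob (measure_pmf (bernoulli_pmf t) \<bind>
    (\<lambda>b. if b then return borel x else measure_of_prob \<mu>))"

text \<open>With the mixture written as a bind over a Bernoulli variable, total mass 1 comes from
  \<open>prob_space_bind\<close> and the integral from \<open>integral_bind\<close>, which asks for
  a bound on f and on the masses.\<close>

lemma star_toward_point:
  assumes f: "f \<in> \<C>" and t: "0 \<le> t" "t \<le> 1"
  shows "star f (toward_point \<mu> x t) = star f \<mu> + t * (f x - star f \<mu>)"
proof -
  let ?N = "\<lambda>b. if b then return borel x else measure_of_prob \<mu>"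
  let ?M = "measure_pmf (bernoulli_pmf t)"
  have N_prob: "prob_space (?N b)" and N_sets: "sets (?N b) = sets borel" for b
    by (auto simp: prob_space_measure sets_measure prob_space_return)
  have N: "?N \<in> measurable ?M (subprob_algebra borel)"
    using N_prob N_sets
    by (auto simp: space_subprob_algebra intro: prob_space_imp_subprob_space)
  have sets: "sets (?M \<bind> ?N) = sets borel"
    using N_sets by (intro sets_bind) auto
  have prob: "prob_space (?M \<bind> ?N)"
    using N_prob N by (intro measure_pmf.prob_space_bind[OF _ N]) auto
  have meas: "measure_of_prob (toward_point \<mu> x t) = ?M \<bind> ?N"
    unfolding toward_point_def using sets prob by (intro Abs_borel_prob_inverse) auto
  obtain B where B: "\<And>x. \<bar>f x\<bar> \<le> B" using smooth_bounded[OF f] by blast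
  have "star f (toward_point \<mu> x t) = (\<integral>b. integral\<^sup>L (?N b) f \<partial>?M)"
    unfolding star_def meas
  proof (rule integral_bind[where K=borel and B=B and B'=1])
    show "f \<in> borel_measurable borel" by (rule smooth_borel_measurable[OF f])
    show "finite_measure ?M" by unfold_locales
    show "AE b in ?M. emeasure (?N b) (space (?N b)) \<le> ennreal 1"
      using N_prob by (auto simp: prob_space.emeasure_space_1)
  qed (use N B in auto)
  also have "\<dots> = t * f x + (1 - t) * star f \<mu>"
    using t smooth_borel_measurable[OF f] by (simp add: integral_return star_def)
  finally show ?thesis by (simp add: algebra_simps)
qed

text \<open>Each \<open>star (f i)\<close> moves affinely in t with slope
  \<open>f i x - star (f i) \<mu>\<close>, so u becomes F on a line. The derivative is one-sided
  because the mixture is guaranteed to be a probability measure only for t in [0, 1].\<close>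

lemma cyl_rep_right_derivative:
  assumes "cyl_rep d A u k F f"
  shows "((\<lambda>t. u (toward_point \<mu> x t)) has_real_derivative
    (\<Sum>i<k. partial_deriv i F (star_tuple k f \<mu>) * (f i x - star (f i) \<mu>))) (at 0 within {0..1})"
proof -
  let ?b = "\<lambda>i. f i x - star (f i) \<mu>"
  have F: "smooth_on k (topspace (Euclidean_space k)) F" and f: "\<And>i. i < k \<Longrightarrow> f i \<in> \<C>"
    and u: "u = F \<circ> star_tuple k f"
    using assms by (auto simp: cyl_rep_def)
  have "star_tuple k f \<mu> \<in> topspace (Euclidean_space k)"
    by (auto simp: topspace_Euclidean_space star_tuple_def)
  from partial_has_line_derivative[OF F this order_refl, of ?b]
  have "((\<lambda>t. F (\<lambda>i. if i < k then star_tuple k f \<mu> i + t * ?b i else star_tuple k f \<mu> i))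
      has_real_derivative (\<Sum>i<k. partial_deriv i F (star_tuple k f \<mu>) * ?b i)) (at 0 within {0..1})"
    by (rule has_field_derivative_at_within)
  then show ?thesis
  proof (rule has_field_derivative_transform_within[where d=1])
    fix t :: real assume "t \<in> {0..1}"
    then have "star_tuple k f (toward_point \<mu> x t) =
        (\<lambda>i. if i < k then star_tuple k f \<mu> i + t * ?b i else star_tuple k f \<mu> i)"
      by (auto simp: star_tuple_def star_toward_point f fun_eq_iff)
    then show "F (\<lambda>i. if i < k then star_tuple k f \<mu> i + t * ?b i else star_tuple k f \<mu> i) =
        u (toward_point \<mu> x t)"
      by (simp add: u)
  qed auto
qed

text \<open>Two representations of \<open>u\<close> have the same derivative towards each \<open>\<delta>\<^sub>x\<close>, so the functions
  \<open>\<Sum>\<^sub>i (\<partial>\<^sub>iF) f\<^sub>i\<close> that they yield differ by a constant.\<close>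

lemma cyl_rep_differential_unique:
  assumes u: "cyl_rep d A u k F f" and u': "cyl_rep d A u l G g"
  shows "(\<Sum>i<k. partial_deriv i F (star_tuple k f \<mu>) *\<^sub>R differential d A (f i)) =
    (\<Sum>i<l. partial_deriv i G (star_tuple l g \<mu>) *\<^sub>R differential d A (g i))"
proof (intro ext)
  fix x \<xi>
  define a where "a i = partial_deriv i F (star_tuple k f \<mu>)" for i
  define b where "b i = partial_deriv i G (star_tuple l g \<mu>)" for i
  have f: "\<And>i. i < k \<Longrightarrow> f i \<in> \<C>" and g: "\<And>i. i < l \<Longrightarrow> g i \<in> \<C>"
    using u u' by (auto simp: cyl_rep_def)
  define p where "p = (\<Sum>i<k. a i *\<^sub>R f i)"
  define q where "q = (\<Sum>i<l. b i *\<^sub>R g i)"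
  have pq: "p \<in> \<C>" "q \<in> \<C>" using f g by (auto simp: p_def q_def intro!: smooth_sum smooth_scale)
  define c where "c = (\<Sum>i<k. a i * star (f i) \<mu>) - (\<Sum>i<l. b i * star (g i) \<mu>)"
  have "p = q + (\<lambda>_. c)"
  proof
    fix y
    have "(\<Sum>i<k. a i * (f i y - star (f i) \<mu>)) = (\<Sum>i<l. b i * (g i y - star (g i) \<mu>))"
      unfolding a_def b_def
    proof (rule vector_derivative_unique_within)
      show "at (0::real) within {0..1} \<noteq> bot"
        by (simp add: trivial_limit_within islimpt_Icc)
    qed (use cyl_rep_right_derivative[OF u] cyl_rep_right_derivative[OF u'] in
        \<open>auto simp: has_real_derivative_iff_has_vector_derivative\<close>)
    then show "p y = (q + (\<lambda>_. c)) y"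
      by (simp add: p_def q_def c_def sum_fun_apply scaleR_fun_def algebra_simps sum_subtractf)
  qed
  then have "\<xi> p = \<xi> q" if "\<xi> \<in> tangent_space d A x"
    using that pq smooth_const[of c] by (simp add: tangent_add tangent_const)
  moreover have "\<xi> p = (\<Sum>i<k. a i * \<xi> (f i))" "\<xi> q = (\<Sum>i<l. b i * \<xi> (g i))"
    if "\<xi> \<in> tangent_space d A x"
    unfolding p_def q_def using f g
    by (subst tangent_sum[OF that]; auto simp: tangent_scale[OF that] smooth_scale)+
  ultimately have "(\<Sum>i<k. a i * differential d A (f i) x \<xi>) = (\<Sum>i<l. b i * differential d A (g i) x \<xi>)"
    by (cases "\<xi> \<in> tangent_space d A x") (auto simp: differential_def)
  then show "(\<Sum>i<k. partial_deriv i F (star_tuple k f \<mu>) *\<^sub>R differential d A (f i)) x \<xi> =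
    (\<Sum>i<l. partial_deriv i G (star_tuple l g \<mu>) *\<^sub>R differential d A (g i)) x \<xi>"
    by (simp add: sum_fun_apply scaleR_fun_def a_def b_def)
qed

section \<open>The differential and the action of a single vector field\<close>

lemma cyl_differential_rep:
  assumes "cyl_rep d A u k F f" and "\<xi> \<in> tangent_space d A x"
  shows "cyl_differential d A u \<mu> x \<xi> = (\<Sum>i<k. partial_deriv i F (star_tuple k f \<mu>) * \<xi> (f i))"
proof -
  have "cyl_differential d A u \<mu> = (\<Sum>i<k. partial_deriv i F (star_tuple k f \<mu>) *\<^sub>R differential d A (f i))"
    unfolding cyl_differential_def
    using assms(1) cyl_rep_differential_unique by (intro the_equality) blast+
  then show ?thesis
    using assms(2) by (simp add: sum_fun_apply scaleR_fun_def differential_def)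
qed

text \<open>The action of the constant cylinder field \<open>1 \<otimes> w\<close>. The action of a
  general field at \<mu> reduces to it once the coefficients are frozen at \<mu>.\<close>

definition field_action :: "'m vfield \<Rightarrow> ('m borel_prob \<Rightarrow> real) \<Rightarrow> 'm borel_prob \<Rightarrow> real"
  where "field_action w u \<mu> = (\<integral>x. cyl_differential d A u \<mu> x (w x) \<partial>measure_of_prob \<mu>)"

lemma field_action_rep:
  assumes u: "cyl_rep d A u k F f" and w: "w \<in> \<X>"
  shows "field_action w u \<mu> =
    (\<Sum>i<k. partial_deriv i F (star_tuple k f \<mu>) * star (\<lambda>x. w x (f i)) \<mu>)"
proof -
  have "integrable (measure_of_prob \<mu>) (\<lambda>x. w x (f i))" if "i < k" for i
    using u that by (intro smooth_integrable vector_field_smooth[OF w]) (auto simp: cyl_rep_def)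
  then show ?thesis
    unfolding field_action_def
    by (simp add: cyl_differential_rep[OF u vector_field_tangent[OF w]] star_def)
qed


subsection \<open>The algebra of cylinder functions and the action of vector fields\<close>

text \<open>A representation can be moved to any list h that contains the \<open>f i\<close> at
  distinct positions. Concatenating two lists then puts two cylinder functions over one tuple, where
  sums and products are taken in F and G.\<close>

lemma cyl_rep_select:
  assumes "cyl_rep d A u l F f" "inj_on \<sigma> {..<l}" "\<And>i. i < l \<Longrightarrow> \<sigma> i < k \<and> h (\<sigma> i) = f i"
    and "\<And>i. i < k \<Longrightarrow> h i \<in> \<C>"
  shows "cyl_rep d A u k (\<lambda>x. F (select_coords l \<sigma> x)) h"
proof -
  have "select_coords l \<sigma> (star_tuple k h \<mu>) = star_tuple l f \<mu>" for \<mu>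
    using assms(3) by (auto simp: select_coords_def star_tuple_def)
  then show ?thesis
    using assms by (auto simp: cyl_rep_def smooth_on_select_coords)
qed

lemma cyl_common_rep:
  assumes "u \<in> \<F>" "v \<in> \<F>"
  obtains k F G f where "cyl_rep d A u k F f" "cyl_rep d A v k G f"
proof -
  obtain k F f where u: "cyl_rep d A u k F f" using assms by (auto simp: cyl_functions_def)
  obtain l G g where v: "cyl_rep d A v l G g" using assms by (auto simp: cyl_functions_def)
  define h where "h i = (if i < k then f i else g (i - k))" for i
  have h: "h i \<in> \<C>" if "i < k + l" for i
    using that u v by (auto simp: h_def cyl_rep_def)
  have "cyl_rep d A u (k + l) (\<lambda>x. F (select_coords k id x)) h"
    using h by (intro cyl_rep_select[OF u]) (auto simp: h_def)
  moreover have "cyl_rep d A v (k + l) (\<lambda>x. G (select_coords l (\<lambda>i. k + i) x)) h"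
    using h by (intro cyl_rep_select[OF v]) (auto simp: h_def)
  ultimately show thesis by (rule that)
qed

lemma cyl_rep_const: "cyl_rep d A (\<lambda>_. c) 0 (\<lambda>_. c) f"
  by (auto simp: cyl_rep_def smooth_on_const coord_open_Euclidean_space)

lemma cyl_rep_star: "f \<in> \<C> \<Longrightarrow> cyl_rep d A (star f) 1 (\<lambda>x. x 0) (\<lambda>_. f)"
  by (auto simp: cyl_rep_def smooth_on_coordinate coord_open_Euclidean_space star_tuple_def)

lemma cyl_rep_add: "cyl_rep d A u k F f \<Longrightarrow> cyl_rep d A v k G f \<Longrightarrow>
    cyl_rep d A (u + v) k (\<lambda>x. F x + G x) f"
  and cyl_rep_mult: "cyl_rep d A u k F f \<Longrightarrow> cyl_rep d A v k G f \<Longrightarrow>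
    cyl_rep d A (u * v) k (\<lambda>x. F x * G x) f"
  by (auto simp: cyl_rep_def smooth_on_add smooth_on_mult coord_open_Euclidean_space)

lemma cyl_rep_partial: "cyl_rep d A u k F f \<Longrightarrow> i < k \<Longrightarrow>
    cyl_rep d A (partial_deriv i F \<circ> star_tuple k f) k (partial_deriv i F) f"
  by (auto simp: cyl_rep_def smooth_on_partial_deriv)

lemma cyl_rep_in: "cyl_rep d A u k F f \<Longrightarrow> u \<in> \<F>"
  by (auto simp: cyl_functions_def)

lemma cyl_functions_const: "(\<lambda>_. c) \<in> \<F>"
  using cyl_rep_const by (rule cyl_rep_in)

lemma cyl_functions_star: "f \<in> \<C> \<Longrightarrow> star f \<in> \<F>"
  using cyl_rep_star by (rule cyl_rep_in)

lemma cyl_functions_add: "u \<in> \<F> \<Longrightarrow> v \<in> \<F> \<Longrightarrow> u + v \<in> \<F>"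
  by (rule cyl_common_rep[of u v]) (auto intro: cyl_rep_in cyl_rep_add)

lemma cyl_functions_mult: "u \<in> \<F> \<Longrightarrow> v \<in> \<F> \<Longrightarrow> u * v \<in> \<F>"
  by (rule cyl_common_rep[of u v]) (auto intro: cyl_rep_in cyl_rep_mult)

lemma subspace_cyl_functions: "subspace \<F>"
proof (rule subspaceI)
  show "0 \<in> \<F>" using cyl_functions_const[of 0] by (simp add: zero_fun_def)
  show "c *\<^sub>R u \<in> \<F>" if "u \<in> \<F>" for c u
    using cyl_functions_mult[OF cyl_functions_const[of c] that]
    by (simp add: times_fun_def scaleR_fun_def)
qed (rule cyl_functions_add)

section \<open>Vector fields as derivations of cylinder functions\<close>

lemma field_action_eq_sum:
  assumes "cyl_rep d A u k F f" "w \<in> \<X>"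
  shows "field_action w u =
    (\<Sum>i<k. (partial_deriv i F \<circ> star_tuple k f) * star (\<lambda>x. w x (f i)))"
  by (auto simp: sum_fun_apply field_action_rep[OF assms])

lemma field_action_in:
  assumes "w \<in> \<X>" "u \<in> \<F>"
  shows "field_action w u \<in> \<F>"
proof -
  obtain k F f where u: "cyl_rep d A u k F f" using assms by (auto simp: cyl_functions_def)
  show ?thesis
    unfolding field_action_eq_sum[OF u assms(1)]
  proof (rule subspace_sum[OF subspace_cyl_functions])
    fix i assume "i \<in> {..<k}"
    then have "i < k" by simp
    then have "f i \<in> \<C>" using u by (simp add: cyl_rep_def)
    then show "(partial_deriv i F \<circ> star_tuple k f) * star (\<lambda>x. w x (f i)) \<in> \<F>"
      by (rule cyl_functions_mult[OF cyl_rep_in[OF cyl_rep_partial[OF u \<open>i < k\<close>]]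
            cyl_functions_star[OF vector_field_smooth[OF assms(1)]]])
  qed
qed

lemma star_tuple_in: "star_tuple k f \<mu> \<in> topspace (Euclidean_space k)"
  by (auto simp: topspace_Euclidean_space star_tuple_def)

lemma field_action_add:
  assumes w: "w \<in> \<X>" and "u \<in> \<F>" "v \<in> \<F>"
  shows "field_action w (u + v) = field_action w u + field_action w v"
proof -
  obtain k F G f where u: "cyl_rep d A u k F f" and v: "cyl_rep d A v k G f"
    using cyl_common_rep[OF assms(2,3)] .
  show ?thesis
    unfolding field_action_eq_sum[OF u w] field_action_eq_sum[OF v w]
      field_action_eq_sum[OF cyl_rep_add[OF u v] w]
    using u v
    by (auto simp: fun_eq_iff sum_fun_apply cyl_rep_def partial_deriv_add[OF _ _ _ star_tuple_in]
        algebra_simps simp flip: sum.distrib)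
qed

lemma field_action_mult:
  assumes w: "w \<in> \<X>" and "u \<in> \<F>" "v \<in> \<F>"
  shows "field_action w (u * v) = field_action w u * v + u * field_action w v"
proof -
  obtain k F G f where u: "cyl_rep d A u k F f" and v: "cyl_rep d A v k G f"
    using cyl_common_rep[OF assms(2,3)] .
  show ?thesis
    unfolding field_action_eq_sum[OF u w] field_action_eq_sum[OF v w]
      field_action_eq_sum[OF cyl_rep_mult[OF u v] w]
    using u v
    by (auto simp: fun_eq_iff sum_fun_apply cyl_rep_def partial_deriv_mult[OF _ _ _ star_tuple_in]
        sum_distrib_left sum_distrib_right algebra_simps simp flip: sum.distrib)
qed

lemma field_action_const: "w \<in> \<X> \<Longrightarrow> field_action w (\<lambda>_. c) = 0"
  using field_action_eq_sum[OF cyl_rep_const] by simp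

lemma field_action_scale:
  assumes "w \<in> \<X>" "u \<in> \<F>"
  shows "field_action w (c *\<^sub>R u) = c *\<^sub>R field_action w u"
proof -
  have "c *\<^sub>R v = (\<lambda>_. c) * v" for v :: "'m borel_prob \<Rightarrow> real"
    by (auto simp: scaleR_fun_def)
  then show ?thesis
    using field_action_mult[OF assms(1) cyl_functions_const assms(2), of c]
    by (simp add: field_action_const[OF assms(1)])
qed

lemma field_action_star: "w \<in> \<X> \<Longrightarrow> f \<in> \<C> \<Longrightarrow> field_action w (star f) = star (\<lambda>x. w x f)"
  using field_action_eq_sum[OF cyl_rep_star] by (auto simp: fun_eq_iff partial_deriv_coordinate)

lemma field_action_sum:
  assumes "w \<in> \<X>" "\<And>i. i \<in> I \<Longrightarrow> u i \<in> \<F>"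
  shows "field_action w (\<Sum>i\<in>I. u i) = (\<Sum>i\<in>I. field_action w (u i))"
  using assms(2)
proof (induction I rule: infinite_finite_induct)
  case (insert i I)
  then have "sum u I \<in> \<F>" by (intro subspace_sum[OF subspace_cyl_functions]) auto
  with insert show ?case by (simp add: field_action_add[OF assms(1)] del: plus_fun_apply)
qed (use field_action_const[OF assms(1), of 0] in \<open>simp_all add: zero_fun_def\<close>)

lemma field_action_field_add:
  assumes w: "w \<in> \<X>" and z: "z \<in> \<X>" and "u \<in> \<F>"
  shows "field_action (w + z) u = field_action w u + field_action z u"
proof -
  obtain k F f where u: "cyl_rep d A u k F f" using assms by (auto simp: cyl_functions_def)
  have "star (\<lambda>x. (w + z) x (f i)) \<mu> = star (\<lambda>x. w x (f i)) \<mu> + star (\<lambda>x. z x (f i)) \<mu>"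
    if "i < k" for i \<mu>
  proof -
    have "f i \<in> \<C>" using u that by (simp add: cyl_rep_def)
    from star_add[OF vector_field_smooth[OF w this] vector_field_smooth[OF z this]]
    show ?thesis by (simp add: plus_fun_def)
  qed
  then show ?thesis
    unfolding field_action_eq_sum[OF u w] field_action_eq_sum[OF u z]
      field_action_eq_sum[OF u subspace_add[OF subspace_vector_fields w z]]
    by (auto simp: fun_eq_iff sum_fun_apply algebra_simps simp flip: sum.distrib)
qed

lemma field_action_field_scale:
  assumes w: "w \<in> \<X>" and "u \<in> \<F>"
  shows "field_action (c *\<^sub>R w) u = c *\<^sub>R field_action w u"
proof -
  obtain k F f where u: "cyl_rep d A u k F f" using assms by (auto simp: cyl_functions_def)
  have "star (\<lambda>x. (c *\<^sub>R w) x (f i)) \<mu> = c * star (\<lambda>x. w x (f i)) \<mu>" for i \<mu>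
    using star_scale[of c "\<lambda>x. w x (f i)" \<mu>] by (simp add: scaleR_fun_def)
  then show ?thesis
    unfolding field_action_eq_sum[OF u w]
      field_action_eq_sum[OF u subspace_scale[OF subspace_vector_fields w]]
    by (auto simp: fun_eq_iff sum_fun_apply scaleR_fun_def sum_distrib_left algebra_simps)
qed

text \<open>The product rule on \<open>(\<partial>\<^sub>iF) (z f\<^sub>i)\<^sup>\<star>\<close>:
  differentiating the first factor gives the Hessian part, differentiating the second composes the
  two fields.\<close>

lemma field_action_field_action:
  assumes w: "w \<in> \<X>" and z: "z \<in> \<X>" and u: "cyl_rep d A u k F f"
  shows "field_action w (field_action z u) \<mu> =
    (\<Sum>i<k. \<Sum>j<k. partial_deriv j (partial_deriv i F) (star_tuple k f \<mu>) *
      star (\<lambda>x. w x (f j)) \<mu> * star (\<lambda>x. z x (f i)) \<mu>) +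
    (\<Sum>i<k. partial_deriv i F (star_tuple k f \<mu>) * star (\<lambda>x. w x (\<lambda>y. z y (f i))) \<mu>)"
proof -
  have f: "f i \<in> \<C>" if "i < k" for i using u that by (simp add: cyl_rep_def)
  let ?P = "\<lambda>i. partial_deriv i F \<circ> star_tuple k f"
  let ?Z = "\<lambda>i. star (\<lambda>x. z x (f i))"
  have P: "?P i \<in> \<F>" if "i < k" for i by (rule cyl_rep_in[OF cyl_rep_partial[OF u that]])
  have Z: "?Z i \<in> \<F>" if "i < k" for i
    by (rule cyl_functions_star[OF vector_field_smooth[OF z f[OF that]]])
  have "field_action w (field_action z u) = (\<Sum>i<k. field_action w (?P i * ?Z i))"
    unfolding field_action_eq_sum[OF u z]
    by (intro field_action_sum w cyl_functions_mult P Z) auto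
  also have "\<dots> = (\<Sum>i<k. field_action w (?P i) * ?Z i + ?P i * field_action w (?Z i))"
    by (intro sum.cong refl field_action_mult w P Z) auto
  also have "\<dots> = (\<Sum>i<k. (\<Sum>j<k. (partial_deriv j (partial_deriv i F) \<circ> star_tuple k f) *
      star (\<lambda>x. w x (f j))) * ?Z i + ?P i * star (\<lambda>x. w x (\<lambda>y. z y (f i))))"
    by (intro sum.cong refl)
      (simp add: field_action_eq_sum[OF cyl_rep_partial[OF u] w] field_action_star[OF w]
        vector_field_smooth[OF z] f)
  finally show ?thesis
    by (simp add: sum_fun_apply sum.distrib sum_distrib_right)
qed

text \<open>The Hessian parts of the two compositions agree after an exchange of summation indices,
  by symmetry of second derivatives. Only first-order terms remain.\<close>

lemma field_action_commutator:
  assumes w: "w \<in> \<X>" and z: "z \<in> \<X>" and "u \<in> \<F>"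
  shows "field_action w (field_action z u) - field_action z (field_action w u) =
    field_action (vf_bracket w z) u"
proof
  fix \<mu>
  obtain k F f where u: "cyl_rep d A u k F f" using assms by (auto simp: cyl_functions_def)
  have f: "f i \<in> \<C>" if "i < k" for i using u that by (simp add: cyl_rep_def)
  have F: "smooth_on k (topspace (Euclidean_space k)) F" using u by (simp add: cyl_rep_def)
  let ?H = "\<lambda>i j. partial_deriv j (partial_deriv i F) (star_tuple k f \<mu>)"
  have "(\<Sum>i<k. \<Sum>j<k. ?H i j * star (\<lambda>x. w x (f j)) \<mu> * star (\<lambda>x. z x (f i)) \<mu>) =
      (\<Sum>j<k. \<Sum>i<k. ?H j i * star (\<lambda>x. w x (f j)) \<mu> * star (\<lambda>x. z x (f i)) \<mu>)"
    by (subst sum.swap)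
      (intro sum.cong refl, simp add: partial_deriv_commute[OF F _ _ star_tuple_in])
  also have "\<dots> = (\<Sum>i<k. \<Sum>j<k. ?H i j * star (\<lambda>x. z x (f j)) \<mu> * star (\<lambda>x. w x (f i)) \<mu>)"
    by (intro sum.cong refl) simp
  finally have "(field_action w (field_action z u) - field_action z (field_action w u)) \<mu> =
      (\<Sum>i<k. partial_deriv i F (star_tuple k f \<mu>) * star (\<lambda>x. w x (\<lambda>y. z y (f i))) \<mu>) -
      (\<Sum>i<k. partial_deriv i F (star_tuple k f \<mu>) * star (\<lambda>x. z x (\<lambda>y. w y (f i))) \<mu>)"
    by (simp add: field_action_field_action[OF w z u] field_action_field_action[OF z w u])
  also have "\<dots> = (\<Sum>i<k. partial_deriv i F (star_tuple k f \<mu>) * star (\<lambda>x. vf_bracket w z x (f i)) \<mu>)"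
  proof -
    have "star (\<lambda>x. vf_bracket w z x (f i)) \<mu> =
        star (\<lambda>x. w x (\<lambda>y. z y (f i))) \<mu> - star (\<lambda>x. z x (\<lambda>y. w y (f i))) \<mu>" if "i < k" for i
    proof -
      have "(\<lambda>x. vf_bracket w z x (f i)) = (\<lambda>x. w x (\<lambda>y. z y (f i))) - (\<lambda>x. z x (\<lambda>y. w y (f i)))"
        using f[OF that] by (auto simp: vf_bracket_def)
      then show ?thesis
        using star_diff[of "\<lambda>x. w x (\<lambda>y. z y (f i))" "\<lambda>x. z x (\<lambda>y. w y (f i))"] f[OF that]
        by (simp only: vector_field_smooth[OF w] vector_field_smooth[OF z])
    qed
    then show ?thesis by (simp add: right_diff_distrib sum_subtractf)
  qed
  also have "\<dots> = field_action (vf_bracket w z) u \<mu>"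
    by (rule field_action_rep[OF u vf_bracket_in[OF w z], symmetric])
  finally show "(field_action w (field_action z u) - field_action z (field_action w u)) \<mu> =
    field_action (vf_bracket w z) u \<mu>" .
qed


subsection \<open>Faithfulness of the action\<close>

lemma smooth_power: "f \<in> \<C> \<Longrightarrow> (\<lambda>x. f x ^ n) \<in> \<C>"
proof (induction n)
  case (Suc n)
  from smooth_mult[OF Suc.prems Suc.IH[OF Suc.prems]] show ?case by (simp add: times_fun_def)
qed (simp add: smooth_const)

text \<open>If \<open>V\<close> has finite rank then so has its commutator with multiplication by \<open>f\<close>, which is
  multiplication by \<open>V f\<close>. Hence \<open>V f\<close> is algebraic, so constant, and if this constant is not zero
  then \<open>f\<close> itself is algebraic, so constant.\<close>

lemma finite_rank_vector_field_zero:
  assumes V: "V \<in> \<X>" and "finite I"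
    and rank: "\<And>f x. f \<in> \<C> \<Longrightarrow> V x f = (\<Sum>i\<in>I. L i f * k i x)"
  shows "V = 0"
proof -
  have "V x f = 0" if f: "f \<in> \<C>" for f x
  proof (rule ccontr)
    assume nz: "V x f \<noteq> 0"
    define r where "r y = V y f" for y
    have r: "r \<in> \<C>" unfolding r_def by (rule vector_field_smooth[OF V f])
    \<comment> \<open>The span contains the range of the commutator
      \<open>g \<mapsto> V (f g) - f (V g)\<close>: the first part of Q serves
      \<open>V (f g)\<close>, the second \<open>f (V g)\<close>.\<close>
    define Q where "Q = k ` I \<union> (\<lambda>i. f * k i) ` I"
    have Q: "finite Q" using \<open>finite I\<close> by (simp add: Q_def)
    have in_span: "(\<lambda>y. r y * g y) \<in> span Q" if g: "g \<in> \<C>" for g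
    proof -
      have "(\<lambda>y. r y * g y) = (\<Sum>i\<in>I. L i (f * g) *\<^sub>R k i) - (\<Sum>i\<in>I. L i g *\<^sub>R (f * k i))"
      proof
        fix y
        have "r y * g y = V y (f * g) - f y * V y g"
          using tangent_mult[OF vector_field_tangent[OF V] f g] by (simp add: r_def)
        then show "r y * g y = ((\<Sum>i\<in>I. L i (f * g) *\<^sub>R k i) - (\<Sum>i\<in>I. L i g *\<^sub>R (f * k i))) y"
          by (simp add: rank[OF g] rank[OF smooth_mult[OF f g]] sum_fun_apply scaleR_fun_def
              sum_distrib_left algebra_simps)
      qed
      moreover have "(\<Sum>i\<in>I. L i (f * g) *\<^sub>R k i) - (\<Sum>i\<in>I. L i g *\<^sub>R (f * k i)) \<in> span Q"
        by (intro span_diff span_sum span_scale span_base) (auto simp: Q_def)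
      ultimately show ?thesis by simp
    qed
    \<comment> \<open>Here g is the j-th power of r.\<close>
    have "(\<lambda>y. r y ^ Suc j) \<in> span Q" for j
      using in_span[OF smooth_power[OF r], of j] by simp
    then obtain c where c: "r = (\<lambda>_. c)"
      using powers_in_finite_span_imp_constant[OF connected smooth_continuous[OF r] Q] by blast
    with nz have "c \<noteq> 0" by (auto simp: r_def dest: fun_cong[of _ _ x])
    \<comment> \<open>Now r is a nonzero constant c; dividing by c puts the powers of f themselves
      into the span.\<close>
    have "(\<lambda>y. f y ^ Suc j) \<in> span Q" for j
    proof -
      have "inverse c *\<^sub>R (\<lambda>y. r y * f y ^ Suc j) \<in> span Q"
        by (intro span_scale in_span smooth_power f)
      moreover have "inverse c *\<^sub>R (\<lambda>y. r y * f y ^ Suc j) = (\<lambda>y. f y ^ Suc j)"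
        using \<open>c \<noteq> 0\<close> by (auto simp: c scaleR_fun_def)
      ultimately show ?thesis by simp
    qed
    then obtain b where "f = (\<lambda>_. b)"
      using powers_in_finite_span_imp_constant[OF connected smooth_continuous[OF f] Q] by blast
    with nz show False using tangent_const[OF vector_field_tangent[OF V]] by simp
  qed
  moreover have "V x f = 0" if "f \<notin> \<C>" for f x
    using tangent_not_smooth[OF vector_field_tangent[OF V] that] .
  ultimately show ?thesis by (auto simp: fun_eq_iff)
qed

text \<open>The two measures are not compared as such: a cylinder function sees a measure only
  through finitely many integrals, and those agree.\<close>

lemma cyl_functions_toward_point_0:
  assumes "u \<in> \<F>"
  shows "u (toward_point \<mu> x 0) = u \<mu>"
proof -
  obtain k F f where u: "cyl_rep d A u k F f" using assms by (auto simp: cyl_functions_def)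
  have "star_tuple k f (toward_point \<mu> x 0) = star_tuple k f \<mu>"
    using u by (auto simp: cyl_rep_def star_tuple_def star_toward_point fun_eq_iff)
  then show ?thesis using u by (simp add: cyl_rep_def)
qed

lemma field_combination_zero:
  assumes B: "finite B" "B \<subseteq> \<X>" and u: "\<And>b. b \<in> B \<Longrightarrow> u b \<in> \<F>"
    and zero: "\<And>f \<nu>. f \<in> \<C> \<Longrightarrow> (\<Sum>b\<in>B. u b \<nu> * star (\<lambda>x. b x f) \<nu>) = 0"
  shows "(\<Sum>b\<in>B. u b \<mu> *\<^sub>R b) = 0"
proof -
  have "\<exists>D. \<forall>x. ((\<lambda>t. u b (toward_point \<mu> x t)) has_real_derivative D x) (at 0 within {0..1})"
    if "b \<in> B" for b
  proof -
    have "u b \<in> \<F>" using that by (rule u)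
    then obtain k F f where rep: "cyl_rep d A (u b) k F f" by (auto simp: cyl_functions_def)
    show ?thesis by (rule exI, rule allI, rule cyl_rep_right_derivative[OF rep])
  qed
  \<comment> \<open>D is fixed before any f is chosen, so \<open>D b x\<close> depends on b and x
    alone. It becomes the x-factor of the finite rank decomposition, with
    \<open>- star (\<lambda>y. b y f) \<mu>\<close> as its coefficient.\<close>
  then obtain D where D: "\<And>b x. b \<in> B \<Longrightarrow>
      ((\<lambda>t. u b (toward_point \<mu> x t)) has_real_derivative D b x) (at 0 within {0..1})"
    by metis
  let ?V = "\<Sum>b\<in>B. u b \<mu> *\<^sub>R b"
  have "?V x f = (\<Sum>b\<in>B. - star (\<lambda>y. b y f) \<mu> * D b x)" if f: "f \<in> \<C>" for f x
  proof -
    define s where "s b = star (\<lambda>y. b y f) \<mu>" for b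
    have "((\<lambda>t. \<Sum>b\<in>B. u b (toward_point \<mu> x t) * (s b + t * (b x f - s b))) has_real_derivative
        (\<Sum>b\<in>B. D b x * (s b + 0 * (b x f - s b)) + (b x f - s b) * u b (toward_point \<mu> x 0)))
        (at 0 within {0..1})"
      by (intro DERIV_sum DERIV_mult' DERIV_mult D) (auto intro!: derivative_eq_intros)
    moreover have "((\<lambda>t. \<Sum>b\<in>B. u b (toward_point \<mu> x t) * (s b + t * (b x f - s b)))
        has_real_derivative 0) (at 0 within {0..1})"
    proof (rule has_field_derivative_transform_within[where f="\<lambda>_. 0" and d=1])
      fix t :: real assume t: "t \<in> {0..1}"
      have "star (\<lambda>y. b y f) (toward_point \<mu> x t) = s b + t * (b x f - s b)" if "b \<in> B" for b
        using star_toward_point[OF vector_field_smooth[OF _ f], of b t \<mu> x] that B t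
        by (auto simp: s_def)
      then show "0 = (\<Sum>b\<in>B. u b (toward_point \<mu> x t) * (s b + t * (b x f - s b)))"
        using zero[OF f, of "toward_point \<mu> x t"] by simp
    qed auto
    ultimately have "(\<Sum>b\<in>B. D b x * (s b + 0 * (b x f - s b)) + (b x f - s b) * u b (toward_point \<mu> x 0)) = 0"
      unfolding has_real_derivative_iff_has_vector_derivative
      by (rule vector_derivative_unique_within[rotated]) (simp add: trivial_limit_within islimpt_Icc)
    then have "(\<Sum>b\<in>B. u b \<mu> * b x f) = (\<Sum>b\<in>B. u b \<mu> * s b) - (\<Sum>b\<in>B. s b * D b x)"
      using u by (simp add: cyl_functions_toward_point_0 algebra_simps sum.distrib sum_subtractf)
    \<comment> \<open>The centring terms \<open>- s b\<close> in the slopes cancel by the hypothesis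
      at \<mu> itself.\<close>
    moreover have "(\<Sum>b\<in>B. u b \<mu> * s b) = 0" unfolding s_def by (rule zero[OF f])
    ultimately show ?thesis
      by (simp add: sum_fun_apply scaleR_fun_def s_def sum_negf)
  qed
  moreover have "?V \<in> \<X>"
    using B by (intro subspace_sum[OF subspace_vector_fields] subspace_scale[OF subspace_vector_fields]) auto
  ultimately show ?thesis
    using finite_rank_vector_field_zero[of ?V B "\<lambda>b f. - star (\<lambda>y. b y f) \<mu>" D] B(1) by blast
qed

text \<open>The action lifted to representatives, where it is linear in p by construction;
  \<open>free_action_null\<close> shows that it descends to cosets.\<close>

definition free_action ::
  "(('m borel_prob \<Rightarrow> real) \<times> 'm vfield, real) poly_mapping \<Rightarrow> ('m borel_prob \<Rightarrow> real) \<Rightarrow> 'm borel_prob \<Rightarrow> real"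
  where "free_action p u = linear_ext (\<lambda>a w. a * field_action w u) p"

lemma free_action_add: "free_action (p + q) u = free_action p u + free_action q u"
  and free_action_scale: "free_action (c *\<^sub>R p) u = c *\<^sub>R free_action p u"
  and free_action_pure: "free_action (pure a w) u = a * field_action w u"
  by (simp_all only: free_action_def linear_ext_add linear_ext_scale linear_ext_pure)

lemma linear_free_action: "linear (\<lambda>p. free_action p u)"
  by (intro linearI free_action_add free_action_scale)

lemma free_action_null:
  assumes "p \<in> tensor_null \<F> \<X>" "u \<in> \<F>"
  shows "free_action p u = 0"
proof -
  have "bilinear_on \<F> \<X> (\<lambda>a w. a * field_action w u)"
    using assms(2)
    unfolding bilinear_on_def
    by (simp add: field_action_field_add field_action_field_scale distrib_left distrib_right
        del: plus_fun_apply times_fun_apply) (simp add: scaleR_fun_def fun_eq_iff)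
  from linear_ext_null[OF this assms(1)] show ?thesis by (simp add: free_action_def)
qed

text \<open>Over independent second factors, vanishing of the field at every \<mu> becomes vanishing
  of every coefficient function. Testing on \<open>star f\<close> is enough because there b acts
  simply by integration of \<open>b f\<close>.\<close>

lemma free_action_injective:
  assumes p: "Poly_Mapping.keys p \<subseteq> \<F> \<times> \<X>"
    and vanish: "\<And>f. f \<in> \<C> \<Longrightarrow> free_action p (star f) = 0"
  shows "p \<in> tensor_null \<F> \<X>"
proof -
  let ?K = "snd ` Poly_Mapping.keys p"
  \<comment> \<open>Drawn from the second factors of p, B is finite and consists of vector
    fields.\<close>
  obtain B where B: "B \<subseteq> ?K" "independent B" "?K \<subseteq> span B"
    by (rule maximal_independent_subset[of ?K])
  have fin: "finite B" using B(1) by (rule finite_subset) simp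
  have BX: "B \<subseteq> \<X>" using B(1) p by fastforce
  have "Poly_Mapping.keys p \<subseteq> \<F> \<times> span B"
    using p B(3) by (auto simp: image_subset_iff)
  from tensor_reduce_basis[OF subspace_cyl_functions subspace_vector_fields fin BX this]
  obtain u where u: "\<And>b. b \<in> B \<Longrightarrow> u b \<in> \<F>"
    and null: "p - (\<Sum>b\<in>B. pure (u b) b) \<in> tensor_null \<F> \<X>" by blast
  have "(\<Sum>b\<in>B. u b \<mu> *\<^sub>R b) = 0" for \<mu>
  proof (rule field_combination_zero[OF fin BX u])
    fix f \<nu> assume f: "f \<in> \<C>"
    interpret linear "\<lambda>p. free_action p (star f)" by (rule linear_free_action)
    have "free_action p (star f) - (\<Sum>b\<in>B. free_action (pure (u b) b) (star f)) = 0"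
      using free_action_null[OF null cyl_functions_star[OF f]] by (simp add: diff sum)
    then have "(\<Sum>b\<in>B. u b * field_action b (star f)) \<nu> = 0"
      by (simp add: vanish[OF f] free_action_pure)
    then show "(\<Sum>b\<in>B. u b \<nu> * star (\<lambda>x. b x f) \<nu>) = 0"
      using BX f by (simp add: sum_fun_apply field_action_star subset_iff)
  qed
  then have "u b \<mu> = 0" if "b \<in> B" for b \<mu>
    using independentD[OF B(2) fin subset_refl, of "\<lambda>b. u b \<mu>"] that by blast
  then have u0: "u b = 0" if "b \<in> B" for b
    using that by auto
  have "pure (u b) b \<in> tensor_null \<F> \<X>" if "b \<in> B" for b
    using tensor_null_scale_left[OF subspace_0[OF subspace_cyl_functions], of b \<X> 0] that BX
    by (auto simp: u0)
  then have "(\<Sum>b\<in>B. pure (u b) b) \<in> tensor_null \<F> \<X>"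
    by (rule subspace_sum[OF subspace_tensor_null])
  from subspace_add[OF subspace_tensor_null null this] show ?thesis by simp
qed


subsection \<open>Cylinder vector fields as derivations\<close>

abbreviation "\<V> \<equiv> cyl_vector_fields d A"
abbreviation "cyl_coset \<equiv> tensor_coset \<F> \<X>"

lemma cyl_coset_in: "Poly_Mapping.keys p \<subseteq> \<F> \<times> \<X> \<Longrightarrow> cyl_coset p \<in> \<V>"
  by (auto simp: cyl_vector_fields_def tensor_product_def)

lemma cyl_vector_fieldE:
  assumes "V \<in> \<V>"
  obtains p where "Poly_Mapping.keys p \<subseteq> \<F> \<times> \<X>" "V = cyl_coset p"
  using assms by (auto simp: cyl_vector_fields_def tensor_product_def)

lemma cyl_eval_coset: "cyl_eval (cyl_coset p) \<mu> = linear_ext (\<lambda>u w. u \<mu> *\<^sub>R w) p"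
proof -
  interpret linear "linear_ext (\<lambda>u (w :: 'm vfield). u \<mu> *\<^sub>R w)" by (rule linear_linear_ext)
  have "bilinear_on \<F> \<X> (\<lambda>u w. u \<mu> *\<^sub>R w)"
    by (auto simp: bilinear_on_def scaleR_add_left scaleR_add_right scaleR_fun_def fun_eq_iff
        algebra_simps)
  then have "linear_ext (\<lambda>u w. u \<mu> *\<^sub>R w) q = linear_ext (\<lambda>u w. u \<mu> *\<^sub>R w) p"
    if "q \<in> cyl_coset p" for q
    using linear_ext_null[of \<F> \<X> "\<lambda>u w. u \<mu> *\<^sub>R w" "q - p"] that by (simp add: tensor_coset_def diff)
  then show ?thesis
    unfolding cyl_eval_def using tensor_coset_self by (intro the_equality) blast+
qed

text \<open>\<open>cyl_action\<close> inserts \<mu> into the coefficients before it acts, whereas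
  \<open>free_action\<close> multiplies by coefficient functions. The two can agree only at the same
  \<mu>, hence the pointwise form.\<close>

lemma field_action_linear_ext:
  assumes "Poly_Mapping.keys p \<subseteq> \<F> \<times> \<X>" "u \<in> \<F>"
  shows "linear_ext (\<lambda>a w. a \<mu> *\<^sub>R w) p \<in> \<X> \<and>
    field_action (linear_ext (\<lambda>a w. a \<mu> *\<^sub>R w) p) u \<mu> = free_action p u \<mu>"
  using assms(1)
proof (induction rule: poly_mapping_pure_induct)
  case zero
  have "field_action (0 *\<^sub>R 0) u = 0 *\<^sub>R field_action 0 u"
    by (rule field_action_field_scale[OF subspace_0[OF subspace_vector_fields] assms(2)])
  then show ?case
    using subspace_0[OF subspace_vector_fields]
    by (simp add: linear_0[OF linear_linear_ext] linear_0[OF linear_free_action] del: zero_fun_apply)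
next
  case (pure c a w)
  then show ?case
    using assms(2) subspace_scale[OF subspace_vector_fields]
    by (simp add: linear_ext_scale linear_ext_pure free_action_scale free_action_pure
        field_action_field_scale) (simp add: scaleR_fun_def)
next
  case (add p q)
  then show ?case
    using assms(2) subspace_add[OF subspace_vector_fields]
    by (simp add: linear_ext_add field_action_field_add del: plus_fun_apply)
      (simp add: free_action_add)
qed

lemma cyl_action_coset:
  assumes "Poly_Mapping.keys p \<subseteq> \<F> \<times> \<X>" "u \<in> \<F>"
  shows "cyl_action d A (cyl_coset p) u = free_action p u"
  using field_action_linear_ext[OF assms]
  by (auto simp: cyl_action_def cyl_eval_coset field_action_def fun_eq_iff)

lemma free_action_in:
  assumes "Poly_Mapping.keys p \<subseteq> \<F> \<times> \<X>" "u \<in> \<F>"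
  shows "free_action p u \<in> \<F>"
  using assms(1)
proof (induction rule: poly_mapping_pure_induct)
  case zero
  then show ?case
    by (simp only: linear_0[OF linear_free_action] subspace_0[OF subspace_cyl_functions])
qed (simp_all add: free_action_add free_action_scale free_action_pure cyl_functions_add assms(2)
    cyl_functions_mult field_action_in subspace_scale[OF subspace_cyl_functions]
    del: plus_fun_apply times_fun_apply)

lemma free_action_diff_right:
  assumes "Poly_Mapping.keys p \<subseteq> \<F> \<times> \<X>" "u \<in> \<F>" "v \<in> \<F>"
  shows "free_action p (u - v) = free_action p u - free_action p v"
  using assms(1)
proof (induction rule: poly_mapping_pure_induct)
  case zero
  then show ?case using linear_0[OF linear_free_action] by simp
next
  case (pure c a w)
  have "field_action w u = field_action w (u - v) + field_action w v"
    using field_action_add[OF pure(2) subspace_diff[OF subspace_cyl_functions assms(2,3)] assms(3)]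
    by simp
  then show ?case
    by (simp add: free_action_scale free_action_pure distrib_left scaleR_add_right
        del: plus_fun_apply times_fun_apply minus_apply)
next
  case (add p q)
  then show ?case by (simp add: free_action_add del: plus_fun_apply minus_apply)
qed

lemma free_action_mult_right:
  assumes "Poly_Mapping.keys p \<subseteq> \<F> \<times> \<X>" "u \<in> \<F>" "v \<in> \<F>"
  shows "free_action p (u * v) = free_action p u * v + u * free_action p v"
  using assms(1)
proof (induction rule: poly_mapping_pure_induct)
  case zero
  then show ?case using linear_0[OF linear_free_action] by simp
next
  case (pure c a w)
  then show ?case
    by (simp add: free_action_scale free_action_pure field_action_mult[OF pure(2) assms(2,3)]
        del: plus_fun_apply times_fun_apply)
      (simp add: fun_eq_iff scaleR_fun_def algebra_simps)
next
  case (add p q)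
  then show ?case by (simp add: free_action_add fun_eq_iff algebra_simps)
qed

lemma cyl_action_in: "V \<in> \<V> \<Longrightarrow> u \<in> \<F> \<Longrightarrow> cyl_action d A V u \<in> \<F>"
  by (auto simp: cyl_action_coset free_action_in elim!: cyl_vector_fieldE)

lemma cyl_action_diff_right: "V \<in> \<V> \<Longrightarrow> u \<in> \<F> \<Longrightarrow> v \<in> \<F> \<Longrightarrow>
    cyl_action d A V (u - v) = cyl_action d A V u - cyl_action d A V v"
  using subspace_diff[OF subspace_cyl_functions, of u v]
  by (auto simp: cyl_action_coset free_action_diff_right elim!: cyl_vector_fieldE)

lemma cyl_action_add_right: "V \<in> \<V> \<Longrightarrow> u \<in> \<F> \<Longrightarrow> v \<in> \<F> \<Longrightarrow>
    cyl_action d A V (u + v) = cyl_action d A V u + cyl_action d A V v"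
  using cyl_action_diff_right[of V "u + v" v] cyl_functions_add[of u v] by simp

lemma cyl_action_mult_right: "V \<in> \<V> \<Longrightarrow> u \<in> \<F> \<Longrightarrow> v \<in> \<F> \<Longrightarrow>
    cyl_action d A V (u * v) = cyl_action d A V u * v + u * cyl_action d A V v"
  by (auto simp: cyl_action_coset free_action_mult_right cyl_functions_mult elim!: cyl_vector_fieldE)

lemma cyl_action_scale_right:
  assumes "V \<in> \<V>" "u \<in> \<F>"
  shows "cyl_action d A V (c *\<^sub>R u) = c *\<^sub>R cyl_action d A V u"
proof -
  obtain p where p: "Poly_Mapping.keys p \<subseteq> \<F> \<times> \<X>" "V = cyl_coset p"
    using assms(1) by (rule cyl_vector_fieldE)
  have "free_action p (c *\<^sub>R u) = c *\<^sub>R free_action p u"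
    using p(1)
  proof (induction rule: poly_mapping_pure_induct)
    case zero
    then show ?case by (simp only: linear_0[OF linear_free_action] scaleR_zero_right)
  next
    case (pure c a w)
    then show ?case
      by (simp add: free_action_scale free_action_pure field_action_scale[OF pure(2) assms(2)])
        (simp add: fun_eq_iff scaleR_fun_def)
  qed (simp add: free_action_add scaleR_add_right del: plus_fun_apply)
  then show ?thesis
    using p assms(2) by (simp add: cyl_action_coset subspace_scale[OF subspace_cyl_functions])
qed

text \<open>The difference of two representatives kills every \<open>star f\<close> and is null by
  \<open>free_action_injective\<close>. Uniqueness of the bracket and the equations among the axioms
  are obtained through this rule.\<close>

lemma cyl_vector_field_eqI:
  assumes V: "V \<in> \<V>" and W: "W \<in> \<V>"
    and eq: "\<And>u. u \<in> \<F> \<Longrightarrow> cyl_action d A V u = cyl_action d A W u"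
  shows "V = W"
proof -
  obtain p where p: "Poly_Mapping.keys p \<subseteq> \<F> \<times> \<X>" "V = cyl_coset p"
    using V by (rule cyl_vector_fieldE)
  obtain q where q: "Poly_Mapping.keys q \<subseteq> \<F> \<times> \<X>" "W = cyl_coset q"
    using W by (rule cyl_vector_fieldE)
  have "p - q \<in> tensor_null \<F> \<X>"
  proof (rule free_action_injective)
    show "Poly_Mapping.keys (p - q) \<subseteq> \<F> \<times> \<X>"
      using keys_add_subset[OF p(1) keys_scaleR_subset[OF q(1), of "-1"]] by simp
    fix f assume "f \<in> \<C>"
    then show "free_action (p - q) (star f) = 0"
      using eq[of "star f"] p q linear_diff[OF linear_free_action[of "star f"], of p q]
      by (simp add: cyl_functions_star cyl_action_coset)
  qed
  then show ?thesis by (simp add: p q tensor_coset_eq_iff)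
qed

section \<open>Vector space and module operations\<close>

lemma cyl_add_in: "V \<in> \<V> \<Longrightarrow> W \<in> \<V> \<Longrightarrow> cyl_add d A V W \<in> \<V>"
  by (auto simp: cyl_add_def tensor_add_coset cyl_coset_in keys_add_subset elim!: cyl_vector_fieldE)

lemma cyl_action_add: "V \<in> \<V> \<Longrightarrow> W \<in> \<V> \<Longrightarrow> u \<in> \<F> \<Longrightarrow>
    cyl_action d A (cyl_add d A V W) u = cyl_action d A V u + cyl_action d A W u"
  by (auto simp: cyl_add_def tensor_add_coset cyl_action_coset free_action_add keys_add_subset
      elim!: cyl_vector_fieldE)

lemma cyl_scale_in: "V \<in> \<V> \<Longrightarrow> cyl_scale d A c V \<in> \<V>"
  by (auto simp: cyl_scale_def tensor_scale_coset keys_scaleR_subset cyl_coset_in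
      elim!: cyl_vector_fieldE)

lemma cyl_action_scale: "V \<in> \<V> \<Longrightarrow> u \<in> \<F> \<Longrightarrow>
    cyl_action d A (cyl_scale d A c V) u = c *\<^sub>R cyl_action d A V u"
  by (auto simp: cyl_scale_def tensor_scale_coset cyl_action_coset free_action_scale
      keys_scaleR_subset elim!: cyl_vector_fieldE)

lemma cyl_zero_in: "cyl_zero d A \<in> \<V>"
  by (simp add: cyl_zero_def cyl_coset_in)

lemma cyl_action_zero: "u \<in> \<F> \<Longrightarrow> cyl_action d A (cyl_zero d A) u = 0"
  using linear_0[OF linear_free_action] by (simp add: cyl_zero_def cyl_action_coset)

text \<open>Multiplication by v carries each of the four kinds of relation to a relation of the same
  kind, so the preimage of \<open>tensor_null\<close> contains \<open>tensor_null\<close>.\<close>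

lemma cyl_mult_coset:
  assumes v: "v \<in> \<F>"
  shows "cyl_mult d A v (cyl_coset p) = cyl_coset (linear_ext (\<lambda>u w. pure (v * u) w) p)"
proof -
  define m where "m = linear_ext (\<lambda>u (w :: 'm vfield). pure (v * u) w)"
  define N where "N = tensor_null \<F> \<X>"
  have lin: "linear m" unfolding m_def by (rule linear_linear_ext)
  have m_pure: "m (pure u w) = pure (v * u) w" for u w
    unfolding m_def by (rule linear_ext_pure)
  have "subspace (m -` N)"
    using lin subspace_tensor_null unfolding N_def by (rule linear_subspace_vimage)
  moreover have "pure (a + a') b - pure a b - pure a' b \<in> m -` N"
    if "a \<in> \<F>" "a' \<in> \<F>" "b \<in> \<X>" for a a' b
    using tensor_null_add_left[OF cyl_functions_mult[OF v that(1)] cyl_functions_mult[OF v that(2)] that(3)]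
    by (simp only: vimage_eq N_def linear_diff[OF lin] m_pure distrib_left)
  moreover have "pure a (b + b') - pure a b - pure a b' \<in> m -` N"
    if "a \<in> \<F>" "b \<in> \<X>" "b' \<in> \<X>" for a b b'
    using tensor_null_add_right[OF cyl_functions_mult[OF v that(1)] that(2,3)]
    by (simp only: vimage_eq N_def linear_diff[OF lin] m_pure)
  moreover have "pure (c *\<^sub>R a) b - c *\<^sub>R pure a b \<in> m -` N"
    if "a \<in> \<F>" "b \<in> \<X>" for c a b
  proof -
    have "v * c *\<^sub>R a = c *\<^sub>R (v * a)" by (auto simp: scaleR_fun_def)
    then show ?thesis
      using tensor_null_scale_left[OF cyl_functions_mult[OF v that(1)] that(2), of c]
      by (simp only: vimage_eq N_def linear_diff[OF lin] linear_scale[OF lin] m_pure)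
  qed
  moreover have "pure a (c *\<^sub>R b) - c *\<^sub>R pure a b \<in> m -` N"
    if "a \<in> \<F>" "b \<in> \<X>" for c a b
    using tensor_null_scale_right[OF cyl_functions_mult[OF v that(1)] that(2), of c]
    by (simp only: vimage_eq N_def linear_diff[OF lin] linear_scale[OF lin] m_pure)
  ultimately have "tensor_null \<F> \<X> \<subseteq> m -` N"
    by (rule tensor_null_least)
  then have "cyl_coset (m q) = cyl_coset (m p)" if "q \<in> cyl_coset p" for q
  proof -
    have "q - p \<in> tensor_null \<F> \<X>" using that by (simp add: tensor_coset_def)
    then have "m (q - p) \<in> N" using \<open>tensor_null \<F> \<X> \<subseteq> m -` N\<close> by blast
    then show ?thesis by (simp only: tensor_coset_eq_iff linear_diff[OF lin] N_def)
  qed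
  then show ?thesis
    unfolding cyl_mult_def m_def[symmetric] using tensor_coset_self by (intro SUP_eq_const) blast+
qed

lemma free_mult:
  assumes v: "v \<in> \<F>" and p: "Poly_Mapping.keys p \<subseteq> \<F> \<times> \<X>"
  defines "m \<equiv> linear_ext (\<lambda>u (w :: 'm vfield). pure (v * u) w)"
  shows "Poly_Mapping.keys (m p) \<subseteq> \<F> \<times> \<X> \<and> free_action (m p) u = v * free_action p u"
  using p
proof (induction rule: poly_mapping_pure_induct)
  case zero
  have "m 0 = 0" unfolding m_def by (rule linear_0[OF linear_linear_ext])
  then show ?case using linear_0[OF linear_free_action] by simp
next
  case (pure c a w)
  have "Poly_Mapping.keys (c *\<^sub>R pure (v * a) w) \<subseteq> \<F> \<times> \<X>"
    by (rule subset_trans[OF keys_scaleR keys_pure[OF cyl_functions_mult[OF v pure(1)] pure(2)]])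
  moreover have "c *\<^sub>R (v * a * field_action w u) = v * c *\<^sub>R (a * field_action w u)"
    by (auto simp: scaleR_fun_def)
  ultimately show ?case
    by (simp only: m_def linear_ext_scale linear_ext_pure free_action_scale free_action_pure)
next
  case (add p q)
  then show ?case
    by (simp add: m_def linear_ext_add free_action_add keys_add_subset distrib_left
        del: plus_fun_apply times_fun_apply)
qed

lemma cyl_mult_in: "v \<in> \<F> \<Longrightarrow> V \<in> \<V> \<Longrightarrow> cyl_mult d A v V \<in> \<V>"
  by (auto simp: cyl_mult_coset free_mult cyl_coset_in elim!: cyl_vector_fieldE)

lemma cyl_action_mult: "v \<in> \<F> \<Longrightarrow> V \<in> \<V> \<Longrightarrow> u \<in> \<F> \<Longrightarrow>
    cyl_action d A (cyl_mult d A v V) u = v * cyl_action d A V u"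
  by (auto simp: cyl_mult_coset cyl_action_coset free_mult elim!: cyl_vector_fieldE)

section \<open>Existence of the bracket\<close>

definition cyl_pure :: "('m borel_prob \<Rightarrow> real) \<Rightarrow> 'm vfield \<Rightarrow> 'm cyl_vfield"
  where "cyl_pure a w = cyl_coset (pure a w)"

lemma cyl_pure_in: "a \<in> \<F> \<Longrightarrow> w \<in> \<X> \<Longrightarrow> cyl_pure a w \<in> \<V>"
  unfolding cyl_pure_def by (intro cyl_coset_in keys_pure)

lemma cyl_action_pure: "a \<in> \<F> \<Longrightarrow> w \<in> \<X> \<Longrightarrow> u \<in> \<F> \<Longrightarrow>
    cyl_action d A (cyl_pure a w) u = a * field_action w u"
  unfolding cyl_pure_def by (subst cyl_action_coset) (simp_all add: free_action_pure)

lemma cyl_vector_field_induct [consumes 1, case_names zero pure add]: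
  assumes "V \<in> \<V>" and "P (cyl_zero d A)"
    and "\<And>a w. a \<in> \<F> \<Longrightarrow> w \<in> \<X> \<Longrightarrow> P (cyl_pure a w)"
    and "\<And>V W. V \<in> \<V> \<Longrightarrow> W \<in> \<V> \<Longrightarrow> P V \<Longrightarrow> P W \<Longrightarrow> P (cyl_add d A V W)"
  shows "P V"
proof -
  obtain p where p: "Poly_Mapping.keys p \<subseteq> \<F> \<times> \<X>" "V = cyl_coset p"
    using assms(1) by (rule cyl_vector_fieldE)
  have "P (cyl_coset p)" using p(1)
  proof (induction rule: poly_mapping_pure_induct)
    case zero
    then show ?case using assms(2) by (simp add: cyl_zero_def)
  next
    case (pure c a w)
    \<comment> \<open>The scalar is absorbed into the first factor, which leaves elementary tensors
      as the only generators.\<close>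
    have "cyl_coset (c *\<^sub>R pure a w) = cyl_pure (c *\<^sub>R a) w"
      using subspace_neg[OF subspace_tensor_null tensor_null_scale_left[OF pure, of c]]
      by (simp add: cyl_pure_def tensor_coset_eq_iff)
    then show ?case using assms(3) pure subspace_scale[OF subspace_cyl_functions] by simp
  next
    case (add p q)
    then show ?case
      using assms(4)[of "cyl_coset p" "cyl_coset q"]
      by (simp add: cyl_coset_in cyl_add_def tensor_add_coset)
  qed
  then show ?thesis by (simp add: p)
qed

text \<open>The property described by \<open>cyl_bracket\<close>, as a relation, so that witnesses
  can be assembled before uniqueness is invoked.\<close>

definition is_bracket :: "'m cyl_vfield \<Rightarrow> 'm cyl_vfield \<Rightarrow> 'm cyl_vfield \<Rightarrow> bool"
  where "is_bracket V Z W \<longleftrightarrow> W \<in> \<V> \<and> (\<forall>u\<in>\<F>. cyl_action d A W u =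
    cyl_action d A V (cyl_action d A Z u) - cyl_action d A Z (cyl_action d A V u))"

lemma is_bracket_zero_left: "Z \<in> \<V> \<Longrightarrow> is_bracket (cyl_zero d A) Z (cyl_zero d A)"
  using cyl_action_diff_right[of Z 0 0] subspace_0[OF subspace_cyl_functions]
  by (auto simp: is_bracket_def cyl_zero_in cyl_action_zero cyl_action_in)

lemma is_bracket_add_left:
  assumes "V \<in> \<V>" "V' \<in> \<V>" "Z \<in> \<V>" "is_bracket V Z W" "is_bracket V' Z W'"
  shows "is_bracket (cyl_add d A V V') Z (cyl_add d A W W')"
  using assms
  by (simp add: is_bracket_def cyl_add_in cyl_action_add cyl_action_in cyl_action_add_right)

text \<open>Makes the rules for the first argument serve for the second as well.\<close>

lemma is_bracket_swap:
  assumes "is_bracket V Z W"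
  shows "is_bracket Z V (cyl_scale d A (-1) W)"
  using assms by (simp add: is_bracket_def cyl_scale_in cyl_action_scale)

text \<open>The product rule for \<open>w (b (z u))\<close> and \<open>z (a (w u))\<close> yields
  the two terms with differentiated coefficients; the undifferentiated ones combine to the
  commutator of w and z.\<close>

lemma is_bracket_pure:
  assumes a: "a \<in> \<F>" and b: "b \<in> \<F>" and w: "w \<in> \<X>" and z: "z \<in> \<X>"
  shows "is_bracket (cyl_pure a w) (cyl_pure b z)
    (cyl_add d A (cyl_pure (a * b) (vf_bracket w z))
      (cyl_add d A (cyl_pure (a * field_action w b) z)
        (cyl_scale d A (-1) (cyl_pure (b * field_action z a) w))))"
proof -
  note [simp] = vf_bracket_in[OF w z] a b w z cyl_functions_mult field_action_in
    cyl_pure_in cyl_scale_in cyl_add_in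
  show ?thesis
    unfolding is_bracket_def
  proof (intro conjI ballI)
    fix u assume [simp]: "u \<in> \<F>"
    have "a * field_action w (b * field_action z u) - b * field_action z (a * field_action w u) =
        a * b * field_action (vf_bracket w z) u +
        (a * field_action w b * field_action z u + -1 *\<^sub>R (b * field_action z a * field_action w u))"
      by (simp add: field_action_mult[OF w b] field_action_mult[OF z a]
          field_action_commutator[OF w z, symmetric] algebra_simps
          del: plus_fun_apply times_fun_apply)
    then show "cyl_action d A (cyl_add d A (cyl_pure (a * b) (vf_bracket w z))
        (cyl_add d A (cyl_pure (a * field_action w b) z)
          (cyl_scale d A (-1) (cyl_pure (b * field_action z a) w)))) u =
      cyl_action d A (cyl_pure a w) (cyl_action d A (cyl_pure b z) u) -
      cyl_action d A (cyl_pure b z) (cyl_action d A (cyl_pure a w) u)"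
      by (simp add: cyl_action_add cyl_action_scale cyl_action_pure
          del: plus_fun_apply times_fun_apply)
  qed simp
qed

lemma ex_is_bracket:
  assumes "V \<in> \<V>" "Z \<in> \<V>"
  shows "\<exists>W. is_bracket V Z W"
  using assms(1)
proof (induction rule: cyl_vector_field_induct)
  case zero
  then show ?case using is_bracket_zero_left[OF assms(2)] by blast
next
  case (pure a w)
  \<comment> \<open>The arguments stand in reverse order so that the induction on Z runs on the
    first argument; the swap comes afterwards.\<close>
  have "\<exists>W. is_bracket Z (cyl_pure a w) W"
    using assms(2)
  proof (induction rule: cyl_vector_field_induct)
    case zero
    then show ?case using is_bracket_zero_left cyl_pure_in pure by blast
  next
    case (pure b z)
    then show ?case using is_bracket_pure \<open>a \<in> \<F>\<close> \<open>w \<in> \<X>\<close> by blast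
  next
    case (add V W)
    then show ?case using is_bracket_add_left cyl_pure_in \<open>a \<in> \<F>\<close> \<open>w \<in> \<X>\<close> by blast
  qed
  then show ?case using is_bracket_swap by blast
next
  case (add V W)
  then show ?case using is_bracket_add_left assms(2) by blast
qed

lemma is_bracket_cyl_bracket:
  assumes "V \<in> \<V>" "Z \<in> \<V>"
  shows "is_bracket V Z (cyl_bracket d A V Z)"
proof -
  obtain W where W: "is_bracket V Z W" using ex_is_bracket[OF assms] by blast
  moreover have "W' = W" if "is_bracket V Z W'" for W'
    using that W unfolding is_bracket_def by (intro cyl_vector_field_eqI) auto
  ultimately have "is_bracket V Z (THE W. is_bracket V Z W)" by (rule theI[of "is_bracket V Z" W])
  then show ?thesis by (simp add: cyl_bracket_def is_bracket_def)
qed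

lemma cyl_bracket_in: "V \<in> \<V> \<Longrightarrow> Z \<in> \<V> \<Longrightarrow> cyl_bracket d A V Z \<in> \<V>"
  and cyl_action_bracket: "V \<in> \<V> \<Longrightarrow> Z \<in> \<V> \<Longrightarrow> u \<in> \<F> \<Longrightarrow> cyl_action d A (cyl_bracket d A V Z) u =
    cyl_action d A V (cyl_action d A Z u) - cyl_action d A Z (cyl_action d A V u)"
  using is_bracket_cyl_bracket[of V Z] by (auto simp: is_bracket_def)

section \<open>The Lie algebroid axioms\<close>

lemmas cyl_closed =
  cyl_add_in cyl_scale_in cyl_zero_in cyl_mult_in cyl_bracket_in cyl_action_in

lemmas cyl_action_simps =
  cyl_action_add cyl_action_scale cyl_action_zero cyl_action_mult cyl_action_bracket
  cyl_action_add_right cyl_action_diff_right cyl_action_scale_right cyl_action_mult_right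

lemma real_lie_algebra_cyl_vector_fields:
  "real_lie_algebra_on \<V> (cyl_add d A) (cyl_zero d A) (cyl_scale d A) (cyl_bracket d A)"
proof unfold_locales
  fix V assume V: "V \<in> \<V>"
  have "cyl_add d A V (cyl_scale d A (-1) V) = cyl_zero d A"
    using V by (intro cyl_vector_field_eqI) (simp_all add: cyl_closed cyl_action_simps)
  then show "\<exists>W\<in>\<V>. cyl_add d A V W = cyl_zero d A"
    using V cyl_scale_in by blast
\<comment> \<open>Each remaining equation is tested on a cylinder function. The Jacobi identity
  becomes the cancellation of threefold compositions of operators.\<close>
qed (simp_all only: cyl_closed,
    (intro cyl_vector_field_eqI;
      simp add: cyl_closed cyl_action_simps algebra_simps del: plus_fun_apply)+)

text \<open>V acts on \<open>v * Z u\<close> by the product rule, whereas \<open>v * Z (V u)\<close>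
  leaves v undifferentiated. The surplus \<open>(V v) * Z u\<close> is the anchor term.\<close>

lemma cyl_bracket_leibniz:
  assumes "V \<in> \<V>" "Z \<in> \<V>" "v \<in> \<F>"
  shows "cyl_bracket d A V (cyl_mult d A v Z) =
    cyl_add d A (cyl_mult d A v (cyl_bracket d A V Z)) (cyl_mult d A (cyl_action d A V v) Z)"
  using assms
  by (intro cyl_vector_field_eqI)
    (simp_all add: cyl_closed cyl_action_simps algebra_simps del: plus_fun_apply times_fun_apply)

end

theorem corollary2p13:
  fixes d :: nat
    and A B :: "('m::{t2_space, second_countable_topology}) chart set"
  assumes smooth: "smooth_atlas d A"
    and closed: "compact (UNIV :: 'm set)"
    and connected: "connected (UNIV :: 'm set)"
    and oriented: "orientation d A B"
  shows "real_lie_algebra_on (cyl_vector_fields d A)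
           (cyl_add d A) (cyl_zero d A) (cyl_scale d A) (cyl_bracket d A) \<and>
         (\<forall>V\<in>cyl_vector_fields d A. \<forall>Z\<in>cyl_vector_fields d A. \<forall>v\<in>cyl_functions d A.
            cyl_bracket d A V (cyl_mult d A v Z) =
              cyl_add d A (cyl_mult d A v (cyl_bracket d A V Z))
                          (cyl_mult d A (cyl_action d A V v) Z))"
proof -
  interpret closed_manifold d A
    using smooth closed connected by unfold_locales
  show ?thesis
    using real_lie_algebra_cyl_vector_fields cyl_bracket_leibniz by blast
qed

end
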